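(* Let $K$ be a number field of signature $(s,t)$, with embeddings $\sigma_1,\dots,\sigma_{s+2t}$ into $\mathbb{C}$ labeled so that $\sigma_1,\dots,\sigma_s$ are the real embeddings and $\overline{\sigma}_{s+k}=\sigma_{s+t+k}$ for all $k=1,\dots,t$. If $s\geq 1$, $t\geq 2$ and $s\geq 2t$, then the group of units $\mathcal{O}_K^*$ has no subgroup $U$ of rank $s$ such that $$\sigma_{s+1}(u)\,\sigma_{s+t+1}(u)=\sigma_{s+2}(u)\,\sigma_{s+t+2}(u)=\dots=\sigma_{s+t}(u)\,\sigma_{s+2t}(u)$$ holds for every $u\in U$.
   Context: A number field $K$ has signature $(s,t)$ if it has exactly $s$ real embeddings and exactly $2t$ complex (non-real) embeddings into $\mathbb{C}$. $\mathcal{O}_K$ is the ring of integers of $K$ and $\mathcal{O}_K^*$ is its group of units. The rank of a subgroup $U\subset\mathcal{O}_K^*$ is its rank as a finitely generated abelian group. *)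

theory Defs
  imports
    Complex_Main
    "HOL-Computational_Algebra.Polynomial"
    "HOL-Algebra.Ring"
    "HOL-Algebra.Free_Abelian_Groups"
begin

definition number_field :: "'k::field_char_0 itself \<Rightarrow> bool" where
  "number_field _ \<longleftrightarrow>
     (\<exists>B. finite_dimensional_vector_space (\<lambda>(q::rat) x::'k. of_rat q * x) B)"

definition complex_embedding :: "('k::field_char_0 \<Rightarrow> complex) \<Rightarrow> bool" where
  "complex_embedding f \<longleftrightarrow>
     f 1 = 1 \<and> (\<forall>x y. f (x + y) = f x + f y) \<and> (\<forall>x y. f (x * y) = f x * f y)"

definition real_embeddings :: "('k::field_char_0 \<Rightarrow> complex) set" where
  "real_embeddings = {f. complex_embedding f \<and> range f \<subseteq> \<real>}"

definition nonreal_embeddings :: "('k::field_char_0 \<Rightarrow> complex) set" where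
  "nonreal_embeddings = {f. complex_embedding f \<and> \<not> range f \<subseteq> \<real>}"

definition has_signature :: "'k::field_char_0 itself \<Rightarrow> nat \<Rightarrow> nat \<Rightarrow> bool" where
  "has_signature _ s t \<longleftrightarrow>
     finite (real_embeddings :: ('k \<Rightarrow> complex) set) \<and>
     finite (nonreal_embeddings :: ('k \<Rightarrow> complex) set) \<and>
     card (real_embeddings :: ('k \<Rightarrow> complex) set) = s \<and>
     card (nonreal_embeddings :: ('k \<Rightarrow> complex) set) = 2 * t"

definition ring_of_integers :: "'k::field_char_0 ring" where
  "ring_of_integers =
     \<lparr>carrier = {x. algebraic_int x}, monoid.mult = (*), one = 1, ring.zero = 0, ring.add = (+)\<rparr>"

definition unit_group :: "'k::field_char_0 monoid" where
  "unit_group = units_of ring_of_integers"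

definition torsion_elements :: "('a, 'b) monoid_scheme \<Rightarrow> 'a set" where
  "torsion_elements G = {x \<in> carrier G. \<exists>n::nat. n > 0 \<and> x [^]\<^bsub>G\<^esub> n = \<one>\<^bsub>G\<^esub>}"

text \<open>A finitely generated abelian group is the product of its finite torsion subgroup and a
  free abelian group; its rank is the rank of that free part, i.e. of the quotient by torsion.\<close>

definition has_rank :: "('a, 'b) monoid_scheme \<Rightarrow> nat \<Rightarrow> bool" where
  "has_rank G r \<longleftrightarrow>
     comm_group G \<and> G Mod torsion_elements G \<cong> free_Abelian_group {..<r}"

end

theory Submission
  imports
    Defs
    "HOL-Computational_Algebra.Fundamental_Theorem_Algebra"
    "HOL-Library.FuncSet"
begin

text \<open>Suppose \<open>U\<close> is such a subgroup. An extension \<open>\<tau>\<close> of \<open>\<sigma>\<^sub>1 \<circ> \<sigma>\<^sub>s\<^sub>+\<^sub>1\<^sup>-\<^sup>1\<close> to the field generated by all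
  conjugates of \<open>K\<close> permutes the embeddings, so it turns the relation
  \<open>\<sigma>\<^sub>s\<^sub>+\<^sub>1 \<sigma>\<^sub>s\<^sub>+\<^sub>t\<^sub>+\<^sub>1 = \<sigma>\<^sub>s\<^sub>+\<^sub>2 \<sigma>\<^sub>s\<^sub>+\<^sub>t\<^sub>+\<^sub>2\<close> into \<open>\<sigma>\<^sub>1 \<sigma>\<^sub>a = \<sigma>\<^sub>b \<sigma>\<^sub>c\<close> on \<open>U\<close> with \<open>a, b, c \<noteq> 1\<close>.
  All complex embeddings have the same modulus on \<open>U\<close>, and by the product formula it is determined by
  the real ones. Since \<open>t \<ge> 2\<close>, the relation then expresses \<open>log \<bar>\<sigma>\<^sub>1\<bar>\<close> through the other real
  logarithms \<open>log \<bar>\<sigma>\<^sub>2\<bar>, \<dots>, log \<bar>\<sigma>\<^sub>s\<bar>\<close>. These \<open>s - 1\<close> numbers therefore control all conjugates of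
  an element of \<open>U\<close>, and since only finitely many algebraic integers of \<open>K\<close> have all conjugates
  bounded, the rank of \<open>U\<close> is at most \<open>s - 1\<close>.\<close>

subsection \<open>Extending homomorphisms between subfields of the complex numbers\<close>

text \<open>A field homomorphism defined on a subfield \<open>F\<close> of the complex numbers.
  \<open>f\<close> is total but constrained on \<open>F\<close> only, so successive extensions all
  live in one type.\<close>

locale partial_hom =
  fixes F :: "complex set" and f :: "complex \<Rightarrow> complex"
  assumes one_mem: "1 \<in> F"
    and add_mem: "x \<in> F \<Longrightarrow> y \<in> F \<Longrightarrow> x + y \<in> F"
    and minus_mem: "x \<in> F \<Longrightarrow> - x \<in> F"
    and mult_mem: "x \<in> F \<Longrightarrow> y \<in> F \<Longrightarrow> x * y \<in> F"
    and inverse_mem: "x \<in> F \<Longrightarrow> inverse x \<in> F"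
    and hom_one: "f 1 = 1"
    and hom_add: "x \<in> F \<Longrightarrow> y \<in> F \<Longrightarrow> f (x + y) = f x + f y"
    and hom_mult: "x \<in> F \<Longrightarrow> y \<in> F \<Longrightarrow> f (x * y) = f x * f y"
begin

lemma zero_mem: "0 \<in> F"
  using add_mem[OF one_mem minus_mem[OF one_mem]] by simp

lemma diff_mem: "x \<in> F \<Longrightarrow> y \<in> F \<Longrightarrow> x - y \<in> F"
  using add_mem[of x "- y"] minus_mem by simp

lemma divide_mem: "x \<in> F \<Longrightarrow> y \<in> F \<Longrightarrow> x / y \<in> F"
  by (simp add: divide_inverse mult_mem inverse_mem)

lemma sum_mem: "(\<And>i. i \<in> I \<Longrightarrow> g i \<in> F) \<Longrightarrow> sum g I \<in> F"
  by (induction I rule: infinite_finite_induct) (auto simp: zero_mem add_mem)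

lemma of_nat_mem: "of_nat n \<in> F"
  by (induction n) (auto simp: zero_mem one_mem add_mem)

lemma of_int_mem: "of_int n \<in> F"
  by (cases n rule: int_cases2) (auto simp: of_nat_mem minus_mem)

lemma of_rat_mem: "of_rat q \<in> F"
  by (cases q) (auto simp: of_rat_rat of_int_mem divide_mem)

lemma hom_zero: "f 0 = 0"
  using hom_add[OF zero_mem zero_mem] by simp

lemma hom_minus: "x \<in> F \<Longrightarrow> f (- x) = - f x"
  using hom_add[of x "- x"] minus_mem[of x] hom_zero by (simp add: add_eq_0_iff)

lemma hom_diff: "x \<in> F \<Longrightarrow> y \<in> F \<Longrightarrow> f (x - y) = f x - f y"
  using hom_add[of x "- y"] minus_mem[of y] by (simp add: hom_minus)

lemma hom_sum: "(\<And>i. i \<in> I \<Longrightarrow> g i \<in> F) \<Longrightarrow> f (sum g I) = (\<Sum>i\<in>I. f (g i))"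
  by (induction I rule: infinite_finite_induct) (auto simp: hom_zero hom_add sum_mem)

lemma hom_nonzero: "x \<in> F \<Longrightarrow> x \<noteq> 0 \<Longrightarrow> f x \<noteq> 0"
  using hom_mult[of x "inverse x"] inverse_mem hom_one by force

lemma hom_inj: "inj_on f F"
  by (rule inj_onI) (metis hom_diff hom_nonzero diff_mem right_minus_eq)

definition polys :: "complex poly set" where
  "polys = {p. \<forall>i. coeff p i \<in> F}"

lemma polys_pCons: "pCons a p \<in> polys \<longleftrightarrow> a \<in> F \<and> p \<in> polys"
  by (auto simp: polys_def coeff_pCons split: nat.splits)

lemma polys_0: "0 \<in> polys"
  by (auto simp: polys_def zero_mem)

lemma polys_add: "p \<in> polys \<Longrightarrow> q \<in> polys \<Longrightarrow> p + q \<in> polys"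
  by (auto simp: polys_def add_mem)

lemma polys_minus: "p \<in> polys \<Longrightarrow> - p \<in> polys"
  by (auto simp: polys_def minus_mem)

lemma polys_diff: "p \<in> polys \<Longrightarrow> q \<in> polys \<Longrightarrow> p - q \<in> polys"
  by (auto simp: polys_def diff_mem)

lemma polys_mult: "p \<in> polys \<Longrightarrow> q \<in> polys \<Longrightarrow> p * q \<in> polys"
  by (auto simp: polys_def coeff_mult intro!: sum_mem mult_mem)

lemma polys_monom: "a \<in> F \<Longrightarrow> monom a n \<in> polys"
  by (auto simp: polys_def zero_mem)

lemma map_polys_add:
  "p \<in> polys \<Longrightarrow> q \<in> polys \<Longrightarrow> map_poly f (p + q) = map_poly f p + map_poly f q"
  by (auto simp: poly_eq_iff polys_def coeff_map_poly hom_zero hom_add)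

lemma map_polys_diff:
  "p \<in> polys \<Longrightarrow> q \<in> polys \<Longrightarrow> map_poly f (p - q) = map_poly f p - map_poly f q"
  by (auto simp: poly_eq_iff polys_def coeff_map_poly hom_zero hom_diff)

lemma map_polys_mult:
  "p \<in> polys \<Longrightarrow> q \<in> polys \<Longrightarrow> map_poly f (p * q) = map_poly f p * map_poly f q"
  by (auto simp: poly_eq_iff polys_def coeff_map_poly hom_zero coeff_mult hom_sum mult_mem hom_mult)

text \<open>Long division never leaves \<open>F\<close>: the only quotients of coefficients that it
  forms have the leading coefficient of \<open>m\<close> as denominator.\<close>

lemma polys_division:
  assumes m: "m \<in> polys" "m \<noteq> 0" and p: "p \<in> polys"
  obtains q r where "q \<in> polys" "r \<in> polys" "p = q * m + r" "r = 0 \<or> degree r < degree m"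
proof -
  have "\<exists>q r. q \<in> polys \<and> r \<in> polys \<and> p = q * m + r \<and> (r = 0 \<or> degree r < degree m)"
    using p
  \<comment> \<open>The zero polynomial and the constants share degree 0; the shifted measure makes
    the passage from a nonzero constant to 0 a descent.\<close>
  proof (induction "if p = 0 then 0 else Suc (degree p)" arbitrary: p rule: less_induct)
    case less
    show ?case
    proof (cases "p = 0 \<or> degree p < degree m")
      case True
      then show ?thesis using less.prems polys_0 by (intro exI[of _ 0] exI[of _ p]) auto
    next
      case False
      define d where "d = monom (lead_coeff p / lead_coeff m) (degree p - degree m)"
      have d: "d \<in> polys"
        using less.prems m unfolding d_def
        by (intro polys_monom divide_mem) (auto simp: polys_def)
      define p' where "p' = p - d * m"
      have p': "p' \<in> polys" unfolding p'_def using d m less.prems by (intro polys_diff polys_mult)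
      have deg: "degree (d * m) \<le> degree p"
        using False degree_mult_le[of d m] degree_monom_le[of "lead_coeff p / lead_coeff m" "degree p - degree m"]
        by (auto simp: d_def)
      have "coeff (d * m) (degree p) = lead_coeff p"
        using False m by (simp add: d_def coeff_monom_mult)
      then have "coeff p' (degree p) = 0" by (simp add: p'_def)
      moreover have "degree p' \<le> degree p" unfolding p'_def using deg by (intro degree_diff_le) auto
      ultimately have "p' = 0 \<or> degree p' < degree p"
        by (metis leading_coeff_0_iff order_le_less)
      then have "(if p' = 0 then 0 else Suc (degree p')) < (if p = 0 then 0 else Suc (degree p))"
        using False by auto
      then obtain q r where qr: "q \<in> polys" "r \<in> polys" "p' = q * m + r" "r = 0 \<or> degree r < degree m"
        using less.hyps[OF _ p'] by blast
      have "p = (q + d) * m + r" using qr(3) by (simp add: p'_def algebra_simps)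
      then show ?thesis using qr d by (blast intro: polys_add)
    qed
  qed
  then show ?thesis using that by blast
qed

end

text \<open>Up to a scalar, \<open>m\<close> is the minimal polynomial of \<open>\<alpha>\<close>
  over \<open>F\<close>; minimal degree stands in for irreducibility. The root
  \<open>\<beta>\<close> of the image of \<open>m\<close> is to become the value of the extended
  homomorphism at \<open>\<alpha>\<close>.\<close>

locale simple_extension = partial_hom +
  fixes \<alpha> \<beta> :: complex and m :: "complex poly"
  assumes m_mem: "m \<in> polys" and m_nonzero: "m \<noteq> 0" and root: "poly m \<alpha> = 0"
    and minimal: "q \<in> polys \<Longrightarrow> q \<noteq> 0 \<Longrightarrow> poly q \<alpha> = 0 \<Longrightarrow> degree m \<le> degree q"
    and image_root: "poly (map_poly f m) \<beta> = 0"
begin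

text \<open>The remainder modulo \<open>m\<close> also vanishes at \<open>\<alpha>\<close>, and
  minimality leaves only 0 in smaller degree.\<close>

lemma vanish_imp_dvd:
  assumes "p \<in> polys" "poly p \<alpha> = 0"
  obtains q where "q \<in> polys" "p = q * m"
proof -
  obtain q r where qr: "q \<in> polys" "r \<in> polys" "p = q * m + r" "r = 0 \<or> degree r < degree m"
    using polys_division[OF m_mem m_nonzero assms(1)] .
  then have "poly r \<alpha> = 0" using assms(2) root by simp
  then have "r = 0" using qr minimal[of r] by fastforce
  then show ?thesis using qr that by simp
qed

definition ext_field :: "complex set" where
  "ext_field = (\<lambda>p. poly p \<alpha>) ` polys"

definition ext_hom :: "complex \<Rightarrow> complex" where
  "ext_hom x = poly (map_poly f (SOME p. p \<in> polys \<and> poly p \<alpha> = x)) \<beta>"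

text \<open>The choice made by \<open>SOME\<close> does not matter: two representatives differ by a
  multiple of \<open>m\<close>, and the image of \<open>m\<close> vanishes at
  \<open>\<beta>\<close>.\<close>

lemma ext_hom_poly:
  assumes "p \<in> polys"
  shows "ext_hom (poly p \<alpha>) = poly (map_poly f p) \<beta>"
proof -
  define q where "q = (SOME q. q \<in> polys \<and> poly q \<alpha> = poly p \<alpha>)"
  have q: "q \<in> polys \<and> poly q \<alpha> = poly p \<alpha>"
    unfolding q_def by (rule someI[of _ p]) (use assms in simp)
  then obtain d where d: "d \<in> polys" "q - p = d * m"
    using vanish_imp_dvd[of "q - p"] polys_diff assms by auto
  have "map_poly f q - map_poly f p = map_poly f d * map_poly f m"
    using q assms d by (simp flip: map_polys_diff map_polys_mult add: m_mem)
  then have "poly (map_poly f q) \<beta> = poly (map_poly f p) \<beta>"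
    using image_root by (metis mult_zero_right poly_diff poly_mult right_minus_eq)
  then show ?thesis by (simp add: ext_hom_def q_def)
qed

text \<open>Euclidean descent on the degree: if \<open>m = a * p + r\<close>, then at
  \<open>\<alpha>\<close> the value of \<open>r\<close> is minus the product of those of
  \<open>a\<close> and \<open>p\<close>, so an inverse for \<open>r\<close> gives one for
  \<open>p\<close>.\<close>

lemma inverse_mem_ext:
  assumes "p \<in> polys" "poly p \<alpha> \<noteq> 0"
  shows "inverse (poly p \<alpha>) \<in> ext_field"
proof -
  have reduced: "\<exists>q\<in>polys. poly q \<alpha> * poly p \<alpha> = 1"
    if "p \<in> polys" "poly p \<alpha> \<noteq> 0" "degree p < degree m" for p
    using that
  proof (induction "degree p" arbitrary: p rule: less_induct)
    case less
    show ?case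
    proof (cases "degree p = 0")
      case True
      then obtain c where c: "p = [:c:]" by (metis degree_eq_zeroE)
      then show ?thesis using less.prems
        by (intro bexI[of _ "[:inverse c:]"]) (auto simp: polys_pCons polys_0 inverse_mem)
    next
      case False
      have "p \<noteq> 0" using less.prems by auto
      then obtain a r where ar: "a \<in> polys" "r \<in> polys" "m = a * p + r" "r = 0 \<or> degree r < degree p"
        using polys_division[OF less.prems(1) _ m_mem] by blast
      have rp: "degree r < degree p" using ar(4) False by auto
      have "a \<noteq> 0" using ar(3) rp less.prems(3) by auto
      have "degree m = degree (a * p)"
        using \<open>a \<noteq> 0\<close> \<open>p \<noteq> 0\<close> rp unfolding ar(3)
        by (intro degree_add_eq_left) (auto simp: degree_mult_eq)
      \<comment> \<open>The degrees of \<open>a\<close> and \<open>p\<close> add up to that of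
        \<open>m\<close>, and \<open>p\<close> is not constant; so \<open>a\<close> is too short to
        vanish at \<open>\<alpha>\<close>.\<close>
      then have "degree a < degree m" using False \<open>a \<noteq> 0\<close> \<open>p \<noteq> 0\<close> by (simp add: degree_mult_eq)
      then have "poly a \<alpha> \<noteq> 0" using minimal ar(1) \<open>a \<noteq> 0\<close> by fastforce
      have eq: "poly r \<alpha> = - poly a \<alpha> * poly p \<alpha>"
        using root unfolding ar(3) by (simp add: add_eq_0_iff2)
      then have "poly r \<alpha> \<noteq> 0" using \<open>poly a \<alpha> \<noteq> 0\<close> less.prems(2) by simp
      then obtain q where "q \<in> polys" "poly q \<alpha> * poly r \<alpha> = 1"
        using less.hyps[OF rp ar(2)] rp less.prems(3) by auto
      then have "poly (- (q * a)) \<alpha> * poly p \<alpha> = 1" using eq by (simp add: mult.assoc)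
      then show ?thesis using \<open>q \<in> polys\<close> ar(1) polys_minus polys_mult by blast
    qed
  qed
  obtain q r where qr: "q \<in> polys" "r \<in> polys" "p = q * m + r" "r = 0 \<or> degree r < degree m"
    using polys_division[OF m_mem m_nonzero assms(1)] .
  then have "poly r \<alpha> = poly p \<alpha>" using root by simp
  then obtain q' where "q' \<in> polys" "poly q' \<alpha> * poly p \<alpha> = 1"
    using reduced[OF qr(2)] qr(4) assms(2) by fastforce
  then show ?thesis unfolding ext_field_def
    by (metis image_eqI inverse_unique mult.commute)
qed

lemma partial_hom_ext: "partial_hom ext_field ext_hom"
proof
  show "1 \<in> ext_field" unfolding ext_field_def
    by (rule image_eqI[of _ _ "[:1:]"]) (auto simp: polys_pCons polys_0 one_mem)
  fix x y assume "x \<in> ext_field" "y \<in> ext_field"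
  then obtain p q where x: "x = poly p \<alpha>" "p \<in> polys" and y: "y = poly q \<alpha>" "q \<in> polys"
    by (auto simp: ext_field_def)
  show "x + y \<in> ext_field" "x * y \<in> ext_field"
    using x y polys_add polys_mult unfolding ext_field_def
    by (metis image_eqI poly_add, metis image_eqI poly_mult)
  show "ext_hom (x + y) = ext_hom x + ext_hom y" "ext_hom (x * y) = ext_hom x * ext_hom y"
    using ext_hom_poly[OF polys_add[OF x(2) y(2)]] ext_hom_poly[OF polys_mult[OF x(2) y(2)]]
      ext_hom_poly[OF x(2)] ext_hom_poly[OF y(2)] x(2) y(2)
    by (simp_all add: x(1) y(1) map_polys_add map_polys_mult)
next
  fix x assume "x \<in> ext_field"
  then obtain p where x: "x = poly p \<alpha>" "p \<in> polys"
    by (auto simp: ext_field_def)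
  show "- x \<in> ext_field"
    using x polys_minus unfolding ext_field_def by (metis image_eqI poly_minus)
  show "inverse x \<in> ext_field"
    using x inverse_mem_ext[of p] \<open>x \<in> ext_field\<close> by (cases "x = 0") auto
next
  show "ext_hom 1 = 1"
    using ext_hom_poly[of "[:1:]"] by (simp add: polys_pCons polys_0 one_mem map_poly_pCons hom_zero hom_one)
qed

lemma base_subset_ext: "F \<subseteq> ext_field"
proof
  fix x assume "x \<in> F"
  then show "x \<in> ext_field" unfolding ext_field_def
    by (intro image_eqI[of _ _ "[:x:]"]) (auto simp: polys_pCons polys_0)
qed

lemma ext_hom_base: "x \<in> F \<Longrightarrow> ext_hom x = f x"
  using ext_hom_poly[of "[:x:]"] by (simp add: polys_pCons polys_0 map_poly_pCons hom_zero)

lemma generator_mem_ext: "\<alpha> \<in> ext_field"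
  unfolding ext_field_def
  by (rule image_eqI[of _ _ "[:0, 1:]"]) (auto simp: polys_pCons polys_0 one_mem zero_mem)

lemma ext_hom_generator: "ext_hom \<alpha> = \<beta>"
  using ext_hom_poly[of "[:0, 1:]"]
  by (simp add: polys_pCons polys_0 one_mem zero_mem map_poly_pCons hom_zero hom_one)

end

context partial_hom
begin

text \<open>\<open>f\<close> is injective on \<open>F\<close>, so it preserves the degree of a
  minimal polynomial of \<open>\<alpha>\<close>; the image is not constant and has a complex root,
  which serves as the value at \<open>\<alpha>\<close>.\<close>

lemma extend_algebraic:
  assumes "algebraic \<alpha>"
  obtains F' f' where "partial_hom F' f'" "F \<subseteq> F'" "\<And>x. x \<in> F \<Longrightarrow> f' x = f x" "\<alpha> \<in> F'"
proof -
  define P where "P q \<longleftrightarrow> q \<in> polys \<and> q \<noteq> 0 \<and> poly q \<alpha> = 0" for q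
  obtain p where p: "\<forall>i. coeff p i \<in> \<int>" "poly p \<alpha> = 0" "p \<noteq> 0"
    using assms by (auto simp: algebraic_def)
  have "\<int> \<subseteq> F" by (auto elim!: Ints_cases simp: of_int_mem)
  then have "P p" using p by (auto simp: P_def polys_def)
  define m where "m = arg_min degree P"
  have m: "P m" and min: "\<And>q. P q \<Longrightarrow> degree m \<le> degree q"
    unfolding m_def using arg_min_nat_lemma[of P p degree] \<open>P p\<close> by blast+
  have "lead_coeff m \<in> F" using m by (auto simp: P_def polys_def)
  then have deg: "degree (map_poly f m) = degree m"
    using hom_nonzero m by (intro map_poly_degree_eq) (auto simp: P_def)
  have "degree m \<noteq> 0"
  proof
    assume "degree m = 0"
    then obtain c where "m = [:c:]" by (metis degree_eq_zeroE)
    then show False using m by (simp add: P_def)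
  qed
  then obtain \<beta> where "poly (map_poly f m) \<beta> = 0"
    using fundamental_theorem_of_algebra[of "map_poly f m"] deg by (auto simp: constant_degree)
  then interpret simple_extension F f \<alpha> \<beta> m
    using m min by unfold_locales (auto simp: P_def)
  show ?thesis
    using that partial_hom_ext base_subset_ext ext_hom_base generator_mem_ext by blast
qed

end

lemma extend_partial_hom:
  assumes "finite S" "\<And>x. x \<in> S \<Longrightarrow> algebraic x" "partial_hom F f"
  obtains F' f' where "partial_hom F' f'" "F \<subseteq> F'" "\<And>x. x \<in> F \<Longrightarrow> f' x = f x" "S \<subseteq> F'"
proof -
  have "\<exists>F' f'. partial_hom F' f' \<and> F \<subseteq> F' \<and> (\<forall>x\<in>F. f' x = f x) \<and> S \<subseteq> F'"
    using assms
  proof (induction S arbitrary: F f rule: finite_induct)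
    case (insert a S)
    obtain F1 f1 where 1: "partial_hom F1 f1" "F \<subseteq> F1" "\<And>x. x \<in> F \<Longrightarrow> f1 x = f x" "a \<in> F1"
      using partial_hom.extend_algebraic[OF insert.prems(2), of a] insert.prems(1) by blast
    obtain F2 f2 where 2: "partial_hom F2 f2" "F1 \<subseteq> F2" "\<forall>x\<in>F1. f2 x = f1 x" "S \<subseteq> F2"
      using insert.IH[OF _ 1(1)] insert.prems(1) by blast
    show ?case
      by (rule exI[of _ F2], rule exI[of _ f2]) (use 1 2 in auto)
  qed auto
  then show ?thesis using that by blast
qed

subsection \<open>Conjugates of algebraic integers\<close>

lemma of_rat_poly_add: "map_poly of_rat (p + q) = map_poly of_rat p + map_poly of_rat q"
  by (auto simp: poly_eq_iff coeff_map_poly of_rat_add)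

lemma of_rat_poly_mult: "map_poly of_rat (p * q) = map_poly of_rat p * map_poly of_rat q"
  by (auto simp: poly_eq_iff coeff_map_poly coeff_mult of_rat_sum of_rat_mult)

lemma of_rat_poly_pderiv: "map_poly of_rat (pderiv p) = pderiv (map_poly of_rat p)"
  by (auto simp: poly_eq_iff coeff_map_poly coeff_pderiv of_rat_mult of_rat_add)

lemma of_rat_poly_eq_0_iff: "map_poly of_rat p = 0 \<longleftrightarrow> p = 0"
  by (auto simp: poly_eq_iff coeff_map_poly)

lemma of_int_poly_mult:
  "map_poly of_int (p * q) = (map_poly of_int p * map_poly of_int q :: 'a::comm_ring_1 poly)"
  by (auto simp: poly_eq_iff coeff_map_poly coeff_mult)

lemma of_int_poly_power:
  "map_poly of_int (p ^ n) = (map_poly of_int p ^ n :: 'a::comm_ring_1 poly)"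
  by (induction n) (auto simp: of_int_poly_mult)

lemma of_int_poly_smult:
  "map_poly of_int (smult c p) = (smult (of_int c) (map_poly of_int p) :: 'a::comm_ring_1 poly)"
  by (auto simp: poly_eq_iff coeff_map_poly)

lemma of_int_poly_inj:
  "map_poly of_int p = (map_poly of_int q :: 'a::ring_char_0 poly) \<longleftrightarrow> p = q"
  by (auto simp: poly_eq_iff coeff_map_poly)

lemma of_rat_of_int_poly: "map_poly of_rat (map_poly of_int p) = map_poly of_int p"
  by (auto simp: poly_eq_iff coeff_map_poly)

lemma clear_denominators:
  fixes p :: "rat poly"
  shows "\<exists>a P. a \<noteq> 0 \<and> smult (of_int a) p = map_poly of_int P"
proof (induction p)
  case 0
  show ?case by (intro exI[of _ 1] exI[of _ 0]) auto
next
  case (pCons c p)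
  then obtain a P where aP: "a \<noteq> 0" "smult (of_int a) p = map_poly of_int P" by blast
  obtain n d where c: "c = of_int n / of_int d" "d \<noteq> 0"
    by (cases c) (auto simp: Fract_of_int_quotient)
  have "smult (of_int (a * d)) (pCons c p) = map_poly of_int (pCons (a * n) (smult d P))"
    using c by (simp add: map_poly_pCons of_int_poly_smult aP(2)[symmetric] mult.commute)
  then show ?case using aP(1) c(2) by (metis mult_eq_0_iff)
qed

text \<open>Clear denominators and divide out the content; as \<open>p\<close> is monic, comparing
  leading coefficients identifies the scalar.\<close>

lemma monic_primitive_multiple:
  fixes p :: "rat poly"
  assumes "lead_coeff p = 1"
  obtains P :: "int poly" where "content P = 1" "map_poly of_int P = smult (of_int (lead_coeff P)) p"
proof -
  obtain a P where aP: "a \<noteq> 0" "smult (of_int a) p = map_poly of_int P"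
    using clear_denominators by blast
  define c Q where "c = content P" and "Q = primitive_part P"
  have P: "P = smult c Q" by (simp add: c_def Q_def)
  have "map_poly of_int P \<noteq> (0 :: rat poly)" using aP assms by (metis leading_coeff_0_iff smult_eq_0_iff of_int_eq_0_iff zero_neq_one)
  then have "P \<noteq> 0" by auto
  then have c: "c \<noteq> 0" and Q: "content Q = 1" by (auto simp: c_def Q_def)
  have "degree P = degree p"
    using aP by (metis degree_map_poly degree_smult_eq of_int_eq_0_iff)
  then have "of_int (lead_coeff P) = (of_int a :: rat)"
    using assms arg_cong[OF aP(2), of "\<lambda>q. coeff q (degree p)"] by (simp add: coeff_map_poly)
  then have "a = lead_coeff P" by simp
  then have a: "a = c * lead_coeff Q" using P by (metis lead_coeff_smult)
  have "smult (of_int c) (map_poly of_int Q) = smult (of_int c) (smult (of_int (lead_coeff Q)) p)"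
    using aP(2) unfolding P a by (simp add: of_int_poly_smult)
  then have "map_poly of_int Q = smult (of_int (lead_coeff Q)) p"
    using c by (metis of_int_eq_0_iff smult_cancel)
  with Q show ?thesis using that by blast
qed

text \<open>Gauss' lemma: the primitive multiples \<open>P\<close> and \<open>Q\<close> of the
  factors have a primitive product, which forces their leading coefficients to be units; hence
  \<open>p\<close> is \<open>P\<close> up to sign.\<close>

lemma monic_factor_integral:
  fixes p q :: "rat poly"
  assumes "lead_coeff p = 1" "lead_coeff q = 1" "p * q = map_poly of_int G"
  obtains P where "p = map_poly of_int P"
proof -
  obtain P where P: "content P = 1" "map_poly of_int P = smult (of_int (lead_coeff P)) p"
    using monic_primitive_multiple[OF assms(1)] .
  obtain Q where Q: "content Q = 1" "map_poly of_int Q = smult (of_int (lead_coeff Q)) q"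
    using monic_primitive_multiple[OF assms(2)] .
  have "map_poly of_int (P * Q) = (map_poly of_int (smult (lead_coeff P * lead_coeff Q) G) :: rat poly)"
    using P(2) Q(2) by (simp add: of_int_poly_mult of_int_poly_smult mult.commute flip: assms(3))
  then have "P * Q = smult (lead_coeff P * lead_coeff Q) G"
    by (simp only: of_int_poly_inj)
  then have "content (P * Q) = normalize (lead_coeff P * lead_coeff Q) * content G"
    by simp
  then have "is_unit (lead_coeff P * lead_coeff Q)"
    by (metis P(1) Q(1) content_mult dvd_triv_left mult_1 normalize_dvd_iff)
  then have unit: "is_unit (lead_coeff P)" by (metis dvd_mult_left)
  then have "lead_coeff P * lead_coeff P = 1"
    by (metis abs_mult_self_eq mult.right_neutral zdvd1_eq)
  then have "p = smult (of_int (lead_coeff P)) (map_poly of_int P)"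
    unfolding P(2) by (metis of_int_1 of_int_mult smult_1_left smult_smult)
  then show ?thesis using that by (metis of_int_poly_smult)
qed

section \<open>Embeddings of a number field and their conjugation\<close>

context
  fixes f :: "'k::field_char_0 \<Rightarrow> complex"
  assumes f: "complex_embedding f"
begin

lemma embedding_one: "f 1 = 1"
  and embedding_add: "f (x + y) = f x + f y"
  and embedding_mult: "f (x * y) = f x * f y"
  using f by (auto simp: complex_embedding_def)

lemma embedding_zero: "f 0 = 0"
  using embedding_add[of 0 0] by simp

lemma embedding_minus: "f (- x) = - f x"
  using embedding_add[of x "- x"] embedding_zero by (simp add: add_eq_0_iff)

lemma embedding_diff: "f (x - y) = f x - f y"
  using embedding_add[of x "- y"] by (simp add: embedding_minus)

lemma embedding_inverse: "f (inverse x) = inverse (f x)"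
  using embedding_mult[of x "inverse x"] embedding_one embedding_zero
  by (cases "x = 0") (auto intro: inverse_unique[symmetric])

lemma embedding_sum: "f (sum g I) = (\<Sum>i\<in>I. f (g i))"
  by (induction I rule: infinite_finite_induct) (auto simp: embedding_zero embedding_add)

lemma embedding_eq_0_iff: "f x = 0 \<longleftrightarrow> x = 0"
  using embedding_mult[of x "inverse x"] embedding_one embedding_zero
  by (cases "x = 0") auto

lemma embedding_inj: "inj f"
  by (rule injI) (metis embedding_diff embedding_eq_0_iff right_minus_eq)

lemma embedding_of_nat: "f (of_nat n) = of_nat n"
  by (induction n) (auto simp: embedding_zero embedding_one embedding_add)

lemma embedding_of_int: "f (of_int n) = of_int n"
  by (cases n rule: int_cases2) (auto simp: embedding_of_nat embedding_minus)

lemma embedding_of_rat: "f (of_rat q) = of_rat q"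
  by (cases q) (auto simp: of_rat_rat divide_inverse embedding_mult embedding_inverse embedding_of_int)

lemma embedding_poly: "f (poly (map_poly of_rat p) x) = poly (map_poly of_rat p) (f x)"
  by (induction p) (auto simp: map_poly_pCons embedding_zero embedding_add embedding_mult embedding_of_rat)

lemma embedding_poly_root:
  "poly (map_poly of_rat p) (f x) = 0 \<longleftrightarrow> poly (map_poly of_rat p) x = 0"
  by (metis embedding_poly embedding_eq_0_iff)

end

lemma algebraic_iff_rat_poly:
  fixes x :: "'a::field_char_0"
  shows "algebraic x \<longleftrightarrow> (\<exists>p. p \<noteq> 0 \<and> poly (map_poly of_rat p) x = 0)"
proof
  assume "algebraic x"
  then obtain p where "p \<noteq> 0" "poly (map_poly of_int p) x = 0" by (rule algebraicE')
  then show "\<exists>p. p \<noteq> 0 \<and> poly (map_poly of_rat p) x = 0"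
    by (intro exI[of _ "map_poly of_int p"])
       (auto simp: of_rat_of_int_poly poly_eq_iff coeff_map_poly)
next
  assume "\<exists>p. p \<noteq> 0 \<and> poly (map_poly of_rat p) x = 0"
  then obtain p where "p \<noteq> 0" "poly (map_poly of_rat p) x = 0" by blast
  then show "algebraic x"
    by (intro algebraicI'[of "map_poly of_rat p"]) (auto simp: of_rat_poly_eq_0_iff coeff_map_poly)
qed

lemma algebraic_embedding: "complex_embedding f \<Longrightarrow> algebraic x \<Longrightarrow> algebraic (f x)"
  by (metis algebraic_iff_rat_poly embedding_poly_root)

lemma number_field_algebraic:
  assumes "number_field TYPE('k::field_char_0)"
  shows "algebraic (x :: 'k)"
proof -
  obtain B where "finite_dimensional_vector_space (\<lambda>(q::rat) x::'k. of_rat q * x) B"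
    using assms by (auto simp: number_field_def)
  then interpret V: finite_dimensional_vector_space "\<lambda>(q::rat) x::'k. of_rat q * x" B .
  \<comment> \<open>The exponents from 0 to \<open>card B\<close> are one more than the dimension,
    so distinct powers are linearly dependent.\<close>
  define S where "S = (\<lambda>i. x ^ i) ` {..card B}"
  show ?thesis
  proof (cases "inj_on (\<lambda>i. x ^ i) {..card B}")
    case True
    then have "card S = Suc (card B)" by (simp add: S_def card_image)
    then have "V.dependent S"
      using V.independent_card_le_dim[of S UNIV] by auto
    moreover have "finite S" by (simp add: S_def)
    ultimately obtain u where u: "\<exists>v\<in>S. u v \<noteq> 0" "(\<Sum>v\<in>S. of_rat (u v) * v) = 0"
      using V.dependent_finite by auto
    define p where "p = (\<Sum>i\<le>card B. monom (of_rat (u (x ^ i)) :: 'k) i)"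
    have coeff: "coeff p i = (if i \<le> card B then of_rat (u (x ^ i)) else 0)" for i
      by (simp add: p_def coeff_sum)
    show ?thesis
    proof (rule algebraicI'[of p])
      show "coeff p i \<in> \<rat>" for i by (simp add: coeff)
      show "p \<noteq> 0" using u(1) by (auto simp: S_def poly_eq_iff coeff)
      have "poly p x = (\<Sum>i\<le>card B. of_rat (u (x ^ i)) * x ^ i)"
        by (simp add: p_def poly_sum poly_monom)
      also have "\<dots> = (\<Sum>v\<in>S. of_rat (u v) * v)"
        unfolding S_def by (subst sum.reindex[OF True]) simp
      finally show "poly p x = 0" using u(2) by simp
    qed
  next
    \<comment> \<open>Two powers coincide, and the difference of the two monomials kills
      \<open>x\<close>.\<close>
    case False
    then obtain i j where ij: "i \<noteq> j" "x ^ i = x ^ j" by (auto simp: inj_on_def)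
    show ?thesis
    proof (rule algebraicI'[of "monom 1 i - monom 1 j"])
      show "monom 1 i - monom 1 j \<noteq> (0 :: 'k poly)"
        using ij(1) by (metis coeff_monom right_minus_eq zero_neq_one)
    qed (use ij in \<open>auto simp: poly_monom\<close>)
  qed
qed

text \<open>\<open>\<tau>\<close> is a homomorphism on a field containing all conjugates, because
  that field contains the finitely many images of a rational basis. Multiplicativity is stated for
  values of two embeddings since the relation on \<open>U\<close> mixes them.\<close>

lemma extend_to_conjugates:
  assumes K: "number_field TYPE('k::field_char_0)"
    and fin: "finite {g :: 'k \<Rightarrow> complex. complex_embedding g}"
    and hom: "partial_hom F f"
  obtains \<tau> where "\<And>x. x \<in> F \<Longrightarrow> \<tau> x = f x"
    and "\<And>g :: 'k \<Rightarrow> complex. complex_embedding g \<Longrightarrow> complex_embedding (\<tau> \<circ> g)"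
    and "inj_on (\<lambda>g :: 'k \<Rightarrow> complex. \<tau> \<circ> g) {g. complex_embedding g}"
    and "\<And>(g :: 'k \<Rightarrow> complex) (h :: 'k \<Rightarrow> complex) x y. complex_embedding g \<Longrightarrow> complex_embedding h \<Longrightarrow>
           \<tau> (g x * h y) = \<tau> (g x) * \<tau> (h y)"
proof -
  obtain B where "finite_dimensional_vector_space (\<lambda>(q::rat) x::'k. of_rat q * x) B"
    using K by (auto simp: number_field_def)
  then interpret V: finite_dimensional_vector_space "\<lambda>(q::rat) x::'k. of_rat q * x" B .
  define S where "S = (\<Union>g\<in>{g :: 'k \<Rightarrow> complex. complex_embedding g}. g ` B)"
  have "finite S" using fin V.finite_Basis by (auto simp: S_def)
  moreover have "algebraic x" if "x \<in> S" for x
    using that number_field_algebraic[OF K] algebraic_embedding by (auto simp: S_def)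
  ultimately obtain F' \<tau> where \<tau>: "partial_hom F' \<tau>" "\<And>x. x \<in> F \<Longrightarrow> \<tau> x = f x" "S \<subseteq> F'"
    using extend_partial_hom[OF _ _ hom] by metis
  interpret partial_hom F' \<tau> by fact
  have mem: "g x \<in> F'" if g: "complex_embedding g" for g :: "'k \<Rightarrow> complex" and x
  proof -
    have "x \<in> range (\<lambda>u. \<Sum>v\<in>B. of_rat (u v) * v)"
      using V.span_Basis V.span_finite[OF V.finite_Basis] by auto
    then obtain u where "x = (\<Sum>v\<in>B. of_rat (u v) * v)" by auto
    then show ?thesis
      using g \<tau>(3) by (auto simp: embedding_sum embedding_mult embedding_of_rat S_def
          intro!: sum_mem mult_mem of_rat_mem)
  qed
  show ?thesis
  proof (rule that[OF \<tau>(2)])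
    show "complex_embedding (\<tau> \<circ> g)" if "complex_embedding g" for g :: "'k \<Rightarrow> complex"
      using that mem[OF that] by (simp add: complex_embedding_def hom_one hom_add hom_mult)
    show "inj_on (\<lambda>g :: 'k \<Rightarrow> complex. \<tau> \<circ> g) {g. complex_embedding g}"
    proof (rule inj_onI, rule ext)
      fix g h :: "'k \<Rightarrow> complex" and x
      assume "g \<in> {g. complex_embedding g}" "h \<in> {g. complex_embedding g}" "\<tau> \<circ> g = \<tau> \<circ> h"
      then show "g x = h x" using inj_onD[OF hom_inj, of "g x" "h x"] mem by (auto simp: fun_eq_iff)
    qed
    show "\<tau> (g x * h y) = \<tau> (g x) * \<tau> (h y)"
      if "complex_embedding g" "complex_embedding h" for g h :: "'k \<Rightarrow> complex" and x y
      using mem that by (simp add: hom_mult)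
  qed
qed

lemma partial_hom_rat: "partial_hom \<rat> (\<lambda>x. x)"
  by unfold_locales auto

text \<open>Minimality over the rationals passes from \<open>u\<close> to \<open>g u\<close> because
  embeddings fix rational coefficients; the homomorphism taking \<open>g u\<close> to
  \<open>\<beta>\<close> is then extended to all conjugates.\<close>

lemma conjugate_roots:
  fixes u :: "'k::field_char_0"
  assumes K: "number_field TYPE('k)"
    and fin: "finite {g :: 'k \<Rightarrow> complex. complex_embedding g}"
    and p: "poly (map_poly of_rat p) u = 0" "p \<noteq> 0"
    and min: "\<And>q. q \<noteq> 0 \<Longrightarrow> poly (map_poly of_rat q) u = 0 \<Longrightarrow> degree p \<le> degree q"
    and g: "complex_embedding g" and \<beta>: "poly (map_poly of_rat p) \<beta> = 0"
  obtains \<tau> where "\<tau> (g u) = \<beta>"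
    and "\<And>g :: 'k \<Rightarrow> complex. complex_embedding g \<Longrightarrow> complex_embedding (\<tau> \<circ> g)"
    and "inj_on (\<lambda>g :: 'k \<Rightarrow> complex. \<tau> \<circ> g) {g. complex_embedding g}"
proof -
  interpret R: partial_hom "\<rat>" "\<lambda>x. x" by (rule partial_hom_rat)
  interpret simple_extension "\<rat>" "\<lambda>x. x" "g u" \<beta> "map_poly of_rat p"
  proof
    show "map_poly of_rat p \<in> R.polys" by (auto simp: R.polys_def coeff_map_poly)
    show "map_poly of_rat p \<noteq> (0 :: complex poly)" using p by (simp add: of_rat_poly_eq_0_iff)
    show "poly (map_poly of_rat p) (g u) = 0" using p g by (simp add: embedding_poly_root)
    show "poly (map_poly (\<lambda>x. x) (map_poly of_rat p)) \<beta> = 0" using \<beta> by simp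
  next
    fix q assume q: "q \<in> R.polys" "q \<noteq> 0" "poly q (g u) = 0"
    define r where "r = map_poly (inv_into UNIV of_rat) q"
    have "of_rat (inv_into UNIV of_rat c) = c" if "c \<in> \<rat>" for c :: complex
      using that by (auto simp: Rats_def intro: f_inv_into_f)
    moreover have "inv_into UNIV of_rat (0 :: complex) = 0"
      by (metis injI inv_f_f of_rat_0 of_rat_eq_iff)
    ultimately have qr: "q = map_poly of_rat r"
      using q(1) by (auto simp: r_def poly_eq_iff coeff_map_poly R.polys_def)
    then have "degree p \<le> degree r"
      using q g by (intro min) (auto simp: embedding_poly_root)
    then show "degree (map_poly of_rat p :: complex poly) \<le> degree q"
      unfolding qr by (simp add: degree_map_poly)
  qed
  obtain \<tau> where \<tau>: "\<And>x. x \<in> ext_field \<Longrightarrow> \<tau> x = ext_hom x"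
    "\<And>g :: 'k \<Rightarrow> complex. complex_embedding g \<Longrightarrow> complex_embedding (\<tau> \<circ> g)"
    "inj_on (\<lambda>g :: 'k \<Rightarrow> complex. \<tau> \<circ> g) {g. complex_embedding g}"
    using extend_to_conjugates[OF K fin partial_hom_ext] by metis
  have "\<tau> (g u) = \<beta>" using \<tau>(1)[OF generator_mem_ext] ext_hom_generator by simp
  then show ?thesis using that \<tau>(2,3) by blast
qed

text \<open>Extended homomorphisms permute the roots of the minimal polynomial \<open>m\<close> of \<open>u\<close> transitively, so each root is
  hit equally often, say \<open>k\<close> times, and the product is \<open>m\<^sup>k\<close>; by Gauss' lemma \<open>m\<close> has integer
  coefficients.\<close>

lemma conjugate_prod_integral:
  fixes u :: "'k::field_char_0"
  assumes K: "number_field TYPE('k)"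
    and fin: "finite {g :: 'k \<Rightarrow> complex. complex_embedding g}"
    and u: "algebraic_int u"
  obtains P where "(\<Prod>g | complex_embedding g. [:- g u, 1:]) = map_poly of_int P"
proof -
  define E where "E = {g :: 'k \<Rightarrow> complex. complex_embedding g}"
  define Z where "Z q \<longleftrightarrow> q \<noteq> 0 \<and> poly (map_poly of_rat q) u = 0" for q
  obtain G where G: "lead_coeff G = 1" "poly (map_poly of_int G) u = 0"
    using u by (auto simp: algebraic_int_altdef_ipoly)
  have "Z (map_poly of_int G)"
    using G of_int_poly_inj[of G 0, where ?'a = rat] by (auto simp: Z_def of_rat_of_int_poly)
  define m where "m = arg_min degree Z"
  have m: "Z m" and min: "\<And>q. Z q \<Longrightarrow> degree m \<le> degree q"
    unfolding m_def using arg_min_nat_lemma[of Z _ degree] \<open>Z (map_poly of_int G)\<close> by blast+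
  define p where "p = smult (inverse (lead_coeff m)) m"
  have p: "p \<noteq> 0" "lead_coeff p = 1" "degree p = degree m" "poly (map_poly of_rat p) u = 0"
    using m by (auto simp: p_def Z_def map_poly_smult of_rat_mult)
  have pmin: "degree p \<le> degree q" if "q \<noteq> 0" "poly (map_poly of_rat q) u = 0" for q
    using min that p by (auto simp: Z_def)
  have "p dvd map_poly of_int G"
  proof -
    define r where "r = map_poly of_int G mod p"
    have "map_poly of_int G = (map_poly of_int G div p) * p + r" by (simp add: r_def)
    from arg_cong[OF this, of "\<lambda>q. poly (map_poly of_rat q) u"]
    have "poly (map_poly of_rat r) u = 0"
      using p(4) G(2) by (simp add: of_rat_poly_add of_rat_poly_mult of_rat_of_int_poly)
    moreover have "r = 0 \<or> degree r < degree p" unfolding r_def using p(1) by (rule degree_mod_less)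
    ultimately have "r = 0" using pmin[of r] by (meson not_le)
    then show ?thesis by (simp add: r_def mod_eq_0_iff_dvd)
  qed
  then obtain q where q: "map_poly of_int G = p * q" by (rule dvdE)
  have "lead_coeff (map_poly of_int G :: rat poly) = 1"
    using G(1) by (simp add: degree_map_poly coeff_map_poly)
  then have lq: "lead_coeff q = 1" using p(2) by (simp add: q lead_coeff_mult)
  obtain P where P: "p = map_poly of_int P"
    using monic_factor_integral[OF p(2) lq q[symmetric]] .
  define pc where "pc = (map_poly of_rat p :: complex poly)"
  define R where "R = {\<beta>. poly pc \<beta> = 0}"
  have pc: "lead_coeff pc = 1" "pc \<noteq> 0"
    using p by (auto simp: pc_def degree_map_poly coeff_map_poly of_rat_poly_eq_0_iff)
  have img: "g u \<in> R" if "g \<in> E" for g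
    using that p(4) by (simp add: E_def R_def pc_def embedding_poly_root)
  show ?thesis
  proof (cases "E = {}")
    case True
    then show ?thesis using that[of 1] by (simp add: E_def)
  next
    case False
    then obtain g0 where g0: "g0 \<in> E" by blast
    have conj: "\<exists>\<tau>. \<tau> (g u) = \<beta> \<and> (\<forall>g\<in>E. \<tau> \<circ> g \<in> E) \<and> inj_on (\<lambda>g. \<tau> \<circ> g) E"
      if g: "g \<in> E" and \<beta>: "\<beta> \<in> R" for g \<beta>
    proof -
      show ?thesis
      proof (rule conjugate_roots[OF K fin p(4,1)])
        show "degree p \<le> degree q" if "q \<noteq> 0" "poly (map_poly of_rat q) u = 0" for q
          using pmin that .
        show "complex_embedding g" "poly (map_poly of_rat p) \<beta> = 0"
          using g \<beta> by (auto simp: E_def R_def pc_def)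
        fix \<tau> assume "\<tau> (g u) = \<beta>"
          and "\<And>g :: 'k \<Rightarrow> complex. complex_embedding g \<Longrightarrow> complex_embedding (\<tau> \<circ> g)"
          and "inj_on (\<lambda>g :: 'k \<Rightarrow> complex. \<tau> \<circ> g) {g. complex_embedding g}"
        then show ?thesis unfolding E_def by blast
      qed
    qed
    have surj: "\<exists>g\<in>E. g u = \<beta>" if \<beta>: "\<beta> \<in> R" for \<beta>
    proof -
      obtain \<tau> where "\<tau> (g0 u) = \<beta>" "\<tau> \<circ> g0 \<in> E"
        using conj[OF g0 \<beta>] g0 by blast
      then show ?thesis by (intro bexI[of _ "\<tau> \<circ> g0"]) auto
    qed
    define fib where "fib \<beta> = {g\<in>E. g u = \<beta>}" for \<beta>
    \<comment> \<open>Composition with a \<open>\<tau>\<close> taking \<open>\<beta>\<close> to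
      \<open>\<gamma>\<close> maps one fibre injectively into the other; exchanging the roots gives
      equality.\<close>
    have card_le: "card (fib \<beta>) \<le> card (fib \<gamma>)" if \<beta>: "\<beta> \<in> R" and \<gamma>: "\<gamma> \<in> R" for \<beta> \<gamma>
    proof -
      obtain g where g: "g \<in> E" "g u = \<beta>" using surj \<beta> by blast
      obtain \<tau> where \<tau>: "\<tau> \<beta> = \<gamma>" "\<forall>g\<in>E. \<tau> \<circ> g \<in> E" "inj_on (\<lambda>g. \<tau> \<circ> g) E"
        using conj[OF g(1) \<gamma>] g(2) by blast
      show ?thesis
      proof (rule card_inj_on_le)
        show "inj_on (\<lambda>g. \<tau> \<circ> g) (fib \<beta>)" by (rule inj_on_subset[OF \<tau>(3)]) (auto simp: fib_def)
        show "(\<lambda>g. \<tau> \<circ> g) ` fib \<beta> \<subseteq> fib \<gamma>" using \<tau> by (auto simp: fib_def)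
        show "finite (fib \<gamma>)" using fin by (simp add: fib_def E_def)
      qed
    qed
    define k where "k = card (fib (g0 u))"
    have k: "card (fib \<beta>) = k" if "\<beta> \<in> R" for \<beta>
      unfolding k_def using card_le that img[OF g0] by (intro antisym) auto
    \<comment> \<open>A multiple root would be some \<open>g u\<close>; then \<open>u\<close> would
      be a root of the derivative, against the minimality of the degree of \<open>p\<close>.\<close>
    have "rsquarefree pc"
      unfolding rsquarefree_roots
    proof (intro allI notI)
      fix \<beta> assume \<beta>: "poly pc \<beta> = 0 \<and> poly (pderiv pc) \<beta> = 0"
      then obtain g where g: "g \<in> E" "g u = \<beta>" using surj by (auto simp: R_def)
      have "poly (map_poly of_rat (pderiv p)) (g u) = (0::complex)"
        using \<beta> g by (simp add: of_rat_poly_pderiv pc_def)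
      then have "poly (map_poly of_rat (pderiv p)) u = 0"
        using g(1) embedding_poly_root[of g "pderiv p" u] by (simp add: E_def)
      moreover have "degree p \<noteq> 0"
      proof
        assume "degree p = 0"
        then obtain c where "p = [:c:]" by (rule degree_eq_zeroE)
        then show False using p(1,4) by (simp add: map_poly_pCons)
      qed
      ultimately show False using pmin[of "pderiv p"] by (simp add: pderiv_eq_0_iff degree_pderiv)
    qed
    then have "pc = (\<Prod>\<beta>\<in>R. [:-\<beta>, 1:])"
      using complex_poly_decompose_rsquarefree[of pc] pc by (simp add: R_def)
    moreover have "(\<Prod>g\<in>E. [:- g u, 1:]) = (\<Prod>\<beta>\<in>R. \<Prod>g\<in>fib \<beta>. [:- g u, 1:])"
      unfolding fib_def using fin img pc
      by (intro prod.group[symmetric]) (auto simp: E_def R_def poly_roots_finite)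
    moreover have "(\<Prod>g\<in>fib \<beta>. [:- g u, 1:]) = [:-\<beta>, 1:] ^ k" if "\<beta> \<in> R" for \<beta>
    proof -
      have "(\<Prod>g\<in>fib \<beta>. [:- g u, 1:]) = (\<Prod>g\<in>fib \<beta>. [:- \<beta>, 1:])"
        by (rule prod.cong) (auto simp: fib_def)
      then show ?thesis using k[OF that] by simp
    qed
    ultimately have "(\<Prod>g\<in>E. [:- g u, 1:]) = pc ^ k"
      by (simp add: prod_power_distrib)
    also have "pc = map_poly of_int P"
      by (simp add: pc_def P of_rat_of_int_poly)
    finally show ?thesis using that[of "P ^ k"] by (simp add: E_def of_int_poly_power)
  qed
qed

subsection \<open>Finiteness of integers with bounded conjugates\<close>

text \<open>Each new factor subtracts \<open>h a\<close> times a coefficient from the preceding one,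
  which multiplies the bound by at most \<open>1 + b\<close>.\<close>

lemma coeff_prod_bound:
  fixes h :: "'a \<Rightarrow> complex"
  assumes "finite A" "\<And>a. a \<in> A \<Longrightarrow> norm (h a) \<le> b" "0 \<le> b"
  shows "norm (coeff (\<Prod>a\<in>A. [:- h a, 1:]) i) \<le> (1 + b) ^ card A"
  using assms
proof (induction A arbitrary: i rule: finite_induct)
  case empty
  show ?case by (simp add: coeff_1)
next
  case (insert a A)
  define q where "q = (\<Prod>a\<in>A. [:- h a, 1:])"
  have q: "norm (coeff q i) \<le> (1 + b) ^ card A" for i
    using insert by (simp add: q_def)
  have "norm (coeff (pCons 0 q) i) \<le> (1 + b) ^ card A"
    using q insert.prems by (cases i) auto
  moreover have "norm (h a * coeff q i) \<le> b * (1 + b) ^ card A"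
    unfolding norm_mult using insert.prems q by (intro mult_mono) auto
  ultimately have "norm (coeff (pCons 0 q) i - h a * coeff q i) \<le> (1 + b) * (1 + b) ^ card A"
    using norm_triangle_ineq4[of "coeff (pCons 0 q) i" "h a * coeff q i"] by (simp add: algebra_simps)
  then show ?case using insert.hyps by (simp add: q_def)
qed

lemma finite_bounded_int_polys:
  "finite {P :: int poly. degree P \<le> n \<and> (\<forall>i. \<bar>coeff P i\<bar> \<le> C)}"
proof (rule finite_subset)
  show "{P :: int poly. degree P \<le> n \<and> (\<forall>i. \<bar>coeff P i\<bar> \<le> C)}
      \<subseteq> Poly ` {xs. set xs \<subseteq> {- C..C} \<and> length xs \<le> Suc n}"
  proof
    fix P :: "int poly" assume P: "P \<in> {P. degree P \<le> n \<and> (\<forall>i. \<bar>coeff P i\<bar> \<le> C)}"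
    then have "coeff P i \<in> {- C..C}" for i by (auto simp: abs_le_iff minus_le_iff)
    then have "set (coeffs P) \<subseteq> {- C..C}"
      unfolding coeffs_def by (auto simp del: atLeastAtMost_iff)
    moreover have "length (coeffs P) \<le> Suc n"
      using P by (cases "P = 0") (auto simp: length_coeffs_degree)
    ultimately show "P \<in> Poly ` {xs. set xs \<subseteq> {- C..C} \<and> length xs \<le> Suc n}"
      by (intro image_eqI[of _ _ "coeffs P"]) auto
  qed
  show "finite (Poly ` {xs. set xs \<subseteq> {- C..C} \<and> length xs \<le> Suc n})"
    by (intro finite_imageI finite_lists_length_le) simp
qed

text \<open>The polynomial with the conjugates of \<open>u\<close> as roots has integer coefficients
  bounded in terms of \<open>b\<close>, so only finitely many such polynomials occur;
  \<open>g0 u\<close> is a root of one of them, and \<open>g0\<close> is injective.\<close>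

lemma finite_bounded_conjugates:
  assumes K: "number_field TYPE('k::field_char_0)"
    and fin: "finite {g :: 'k \<Rightarrow> complex. complex_embedding g}"
    and g0: "complex_embedding (g0 :: 'k \<Rightarrow> complex)"
    and b: "0 \<le> b"
  shows "finite {u :: 'k. algebraic_int u \<and> (\<forall>g. complex_embedding g \<longrightarrow> norm (g u) \<le> b)}"
proof (rule finite_subset)
  define E where "E = {g :: 'k \<Rightarrow> complex. complex_embedding g}"
  define n where "n = card E"
  define C where "C = \<lceil>(1 + b) ^ n\<rceil>"
  define T where "T = {P :: int poly. degree P \<le> n \<and> (\<forall>i. \<bar>coeff P i\<bar> \<le> C)}"
  show "{u :: 'k. algebraic_int u \<and> (\<forall>g. complex_embedding g \<longrightarrow> norm (g u) \<le> b)}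
      \<subseteq> (\<Union>P\<in>T - {0}. g0 -` {z. poly (map_poly of_int P) z = 0})"
  proof
    fix u :: 'k
    assume "u \<in> {u. algebraic_int u \<and> (\<forall>g. complex_embedding g \<longrightarrow> norm (g u) \<le> b)}"
    then have u: "algebraic_int u" "\<And>g. g \<in> E \<Longrightarrow> norm (g u) \<le> b" by (auto simp: E_def)
    obtain P where P: "(\<Prod>g\<in>E. [:- g u, 1:]) = map_poly of_int P"
      using conjugate_prod_integral[OF K fin u(1)] unfolding E_def .
    have "degree (\<Prod>g\<in>E. [:- g u, 1:]) = n"
      by (subst degree_prod_sum_eq) (auto simp: n_def)
    then have "degree P \<le> n" unfolding P by (simp add: degree_map_poly)
    moreover have "\<bar>coeff P i\<bar> \<le> C" for i
    proof -
      have "norm (coeff (\<Prod>g\<in>E. [:- g u, 1:]) i) \<le> (1 + b) ^ n"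
        unfolding n_def using fin u b by (intro coeff_prod_bound) (auto simp: E_def)
      then show ?thesis unfolding P C_def by (simp add: coeff_map_poly le_ceiling_iff)
    qed
    moreover have "poly (\<Prod>g\<in>E. [:- g u, 1:]) (g0 u) = 0"
      using fin g0 by (auto simp: poly_prod E_def)
    moreover have "(\<Prod>g\<in>E. [:- g u, 1:]) \<noteq> 0" using fin by (auto simp: E_def)
    ultimately show "u \<in> (\<Union>P\<in>T - {0}. g0 -` {z. poly (map_poly of_int P) z = 0})"
      unfolding P T_def by (intro UN_I[of P]) auto
  qed
  show "finite (\<Union>P\<in>T - {0}. g0 -` {z. poly (map_poly of_int P) z = 0})"
  proof (intro finite_UN_I finite_vimageI)
    show "finite (T - {0})" unfolding T_def by (intro finite_Diff finite_bounded_int_polys)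
    show "inj g0" using g0 by (rule embedding_inj)
    fix P assume "P \<in> T - {0}"
    then have "map_poly of_int P \<noteq> (0 :: complex poly)"
      using of_int_poly_inj[of P 0, where ?'a = complex] by simp
    then show "finite {z :: complex. poly (map_poly of_int P) z = 0}" by (rule poly_roots_finite)
  qed
qed

text \<open>The product is the absolute value of the constant coefficient of the integral conjugate
  polynomial. The integers obtained from \<open>u\<close> and from its inverse \<open>v\<close>
  multiply to 1 in absolute value.\<close>

lemma unit_prod_conjugates:
  fixes u v :: "'k::field_char_0"
  assumes K: "number_field TYPE('k)"
    and fin: "finite {g :: 'k \<Rightarrow> complex. complex_embedding g}"
    and u: "algebraic_int u" "algebraic_int v" "u * v = 1"
  shows "(\<Prod>g | complex_embedding g. norm (g u)) = 1"
proof -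
  have int_norm: "\<exists>c::int. (\<Prod>g | complex_embedding g. norm (g w)) = of_int \<bar>c\<bar>"
    if w: "algebraic_int w" for w :: 'k
  proof -
    obtain P where P: "(\<Prod>g | complex_embedding g. [:- g w, 1:]) = map_poly of_int P"
      using conjugate_prod_integral[OF K fin w] .
    have "(\<Prod>g | complex_embedding g. norm (g w)) = norm (poly (\<Prod>g | complex_embedding g. [:- g w, 1:]) 0)"
      by (simp add: poly_prod flip: prod_norm)
    also have "\<dots> = of_int \<bar>coeff P 0\<bar>"
      unfolding P by (simp add: poly_0_coeff_0 coeff_map_poly)
    finally show ?thesis by blast
  qed
  obtain c d :: int where c: "(\<Prod>g | complex_embedding g. norm (g u)) = of_int \<bar>c\<bar>"
    and d: "(\<Prod>g | complex_embedding g. norm (g v)) = of_int \<bar>d\<bar>"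
    using int_norm u by metis
  have "(\<Prod>g | complex_embedding g. norm (g u)) * (\<Prod>g | complex_embedding g. norm (g v)) = 1"
    unfolding prod.distrib[symmetric]
    by (intro prod.neutral) (auto simp: u(3) embedding_one simp flip: norm_mult embedding_mult)
  then have "of_int \<bar>c * d\<bar> = (1::real)"
    unfolding c d by (simp add: abs_mult)
  then have "\<bar>c\<bar> = 1" by (metis abs_zmult_eq_1 of_int_eq_1_iff)
  then show ?thesis using c by simp
qed

text \<open>The isomorphism between two images of the field; for \<open>\<sigma> (s + 1)\<close> and
  \<open>\<sigma> 1\<close> it is the map that \<open>\<tau>\<close> extends in the theorem.\<close>

lemma partial_hom_embeddings:
  assumes g: "complex_embedding g" and h: "complex_embedding h"
  shows "partial_hom (range g) (\<lambda>z. h (inv_into UNIV g z))"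
proof -
  have inv: "inv_into UNIV g (g x) = x" for x using embedding_inj[OF g] by simp
  show ?thesis
  proof
    show "1 \<in> range g" using embedding_one[OF g] by (metis rangeI)
    show "h (inv_into UNIV g 1) = 1" using inv[of 1] embedding_one[OF g] embedding_one[OF h] by simp
  next
    fix z assume "z \<in> range g"
    then obtain x where z: "z = g x" by blast
    show "- z \<in> range g" using z embedding_minus[OF g] by (metis rangeI)
    show "inverse z \<in> range g" using z embedding_inverse[OF g] by (metis rangeI)
  next
    fix z w assume "z \<in> range g" "w \<in> range g"
    then obtain x y where xy: "z = g x" "w = g y" by blast
    show "z + w \<in> range g" "z * w \<in> range g"
      using xy embedding_add[OF g] embedding_mult[OF g] by (metis rangeI)+
    show "h (inv_into UNIV g (z + w)) = h (inv_into UNIV g z) + h (inv_into UNIV g w)"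
      using inv[of "x + y"] inv xy by (simp add: embedding_add[OF g] embedding_add[OF h])
    show "h (inv_into UNIV g (z * w)) = h (inv_into UNIV g z) * h (inv_into UNIV g w)"
      using inv[of "x * y"] inv xy by (simp add: embedding_mult[OF g] embedding_mult[OF h])
  qed
qed

subsection \<open>Logarithms and ranks\<close>

text \<open>\<open>l\<close> stands for the logarithms of the conjugates and \<open>c\<close> for
  their common value at the complex embeddings. The sum makes \<open>l 1\<close> a bounded number
  minus \<open>2 * t * c\<close>; the other terms of the relation cannot cancel all of these copies
  of \<open>c\<close>, so \<open>c\<close> is bounded. Indices from 2 on keep \<open>l 1\<close>
  from occurring a second time.\<close>

lemma log_bound:
  fixes l :: "nat \<Rightarrow> real"
  assumes s: "s \<ge> 1" and t: "t \<ge> 2"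
    and sum: "(\<Sum>i=1..s. l i) + 2 * real t * c = 0"
    and equal: "\<And>i. i \<in> {s + 1..s + 2 * t} \<Longrightarrow> l i = c"
    and idx: "i \<in> {2..s + 2 * t}" "j \<in> {2..s + 2 * t}" "k \<in> {2..s + 2 * t}"
    and rel: "l 1 + l i = l j + l k"
    and small: "\<And>i. i \<in> {2..s} \<Longrightarrow> \<bar>l i\<bar> \<le> 1"
    and h: "h \<in> {1..s + 2 * t}"
  shows "\<bar>l h\<bar> \<le> 3 * real s + 6"
proof -
  define S where "S = (\<Sum>i=2..s. l i)"
  have "\<bar>S\<bar> \<le> (\<Sum>i=2..s. 1)"
    unfolding S_def using small by (intro order_trans[OF sum_abs] sum_mono) auto
  then have S: "\<bar>S\<bar> \<le> s" using s by simp
  have l1: "l 1 = - S - 2 * real t * c"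
    using sum s by (simp add: S_def sum.atLeast_Suc_atMost numeral_2_eq_2)
  \<comment> \<open>\<open>d\<close> is 0 at a real index and 1 at a complex one, so one estimate
    covers every combination of real and complex indices.\<close>
  have split: "\<exists>d r. l i = d * c + r \<and> 0 \<le> d \<and> d \<le> 1 \<and> \<bar>r\<bar> \<le> 1" if "i \<in> {2..s + 2 * t}" for i
  proof (cases "i \<le> s")
    case True
    then show ?thesis using small[of i] that by (intro exI[of _ 0] exI[of _ "l i"]) auto
  next
    case False
    then show ?thesis using equal[of i] that by (intro exI[of _ 1] exI[of _ 0]) auto
  qed
  obtain di ri where i: "l i = di * c + ri" "0 \<le> di" "di \<le> 1" "\<bar>ri\<bar> \<le> 1" using split idx(1) by blast
  obtain dj rj where j: "l j = dj * c + rj" "0 \<le> dj" "dj \<le> 1" "\<bar>rj\<bar> \<le> 1" using split idx(2) by blast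
  obtain dk rk where k: "l k = dk * c + rk" "0 \<le> dk" "dk \<le> 1" "\<bar>rk\<bar> \<le> 1" using split idx(3) by blast
  define D where "D = 2 * real t - di + dj + dk"
  have "D * c = - S + ri - rj - rk"
    using rel unfolding l1 i(1) j(1) k(1) D_def by (simp add: algebra_simps)
  then have "\<bar>D * c\<bar> \<le> real s + 3" using S i j k by linarith
  \<comment> \<open>The worst case is \<open>di = 1\<close> and \<open>dj = dk = 0\<close>: at most
    one of the \<open>2 * t\<close> copies of \<open>c\<close> cancels.\<close>
  moreover have "2 * real t - 1 \<le> \<bar>D\<bar>" using i j k by (simp add: D_def)
  then have "(2 * real t - 1) * \<bar>c\<bar> \<le> \<bar>D * c\<bar>" by (simp add: abs_mult mult_right_mono)
  ultimately have c: "2 * real t * \<bar>c\<bar> - \<bar>c\<bar> \<le> real s + 3" by (simp add: algebra_simps)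
  have "4 * \<bar>c\<bar> \<le> 2 * real t * \<bar>c\<bar>" using t by (intro mult_right_mono) auto
  with c have c': "\<bar>c\<bar> \<le> real s + 3" by linarith
  define x where "x = 2 * real t * c"
  \<comment> \<open>By \<open>c\<close> and \<open>c'\<close> the size of \<open>x\<close> is at
    most \<open>s + 3\<close> plus that of \<open>c\<close>, a bound free of \<open>t\<close>;
    adding \<open>s\<close> for the sum \<open>S\<close> gives the final constant.\<close>
  have "\<bar>x\<bar> \<le> 2 * (real s + 3)"
    using c c' by (simp add: x_def abs_mult)
  then have "\<bar>l 1\<bar> \<le> 3 * real s + 6"
    using S unfolding l1 x_def[symmetric] abs_le_iff by auto
  moreover have "\<bar>l h\<bar> \<le> 3 * real s + 6" if "h \<noteq> 1"
    using h that equal[of h] small[of h] c' by (cases "h \<le> s") auto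
  ultimately show ?thesis by (cases "h = 1") auto
qed

section \<open>Rank and the counting argument\<close>

lemma torsion_subgroup:
  assumes "comm_group G"
  shows "subgroup (torsion_elements G) G"
proof -
  interpret comm_group G by fact
  show ?thesis
  proof
    show "torsion_elements G \<subseteq> carrier G" by (auto simp: torsion_elements_def)
    show "\<one>\<^bsub>G\<^esub> \<in> torsion_elements G"
      unfolding torsion_elements_def using nat_pow_one by (auto intro: exI[of _ "1::nat"])
    fix x assume "x \<in> torsion_elements G"
    then obtain m where x: "x \<in> carrier G" "m > 0" "x [^]\<^bsub>G\<^esub> (m::nat) = \<one>\<^bsub>G\<^esub>"
      by (auto simp: torsion_elements_def)
    show "inv\<^bsub>G\<^esub> x \<in> torsion_elements G"
      unfolding torsion_elements_def using x by (auto simp: nat_pow_inv intro!: exI[of _ m])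
    fix y assume "y \<in> torsion_elements G"
    then obtain n where y: "y \<in> carrier G" "n > 0" "y [^]\<^bsub>G\<^esub> (n::nat) = \<one>\<^bsub>G\<^esub>"
      by (auto simp: torsion_elements_def)
    have "(x \<otimes>\<^bsub>G\<^esub> y) [^]\<^bsub>G\<^esub> (m * n) = x [^]\<^bsub>G\<^esub> (m * n) \<otimes>\<^bsub>G\<^esub> y [^]\<^bsub>G\<^esub> (n * m)"
      using x y by (simp add: nat_pow_distrib mult.commute)
    also have "\<dots> = \<one>\<^bsub>G\<^esub>"
      using x y by (simp flip: nat_pow_pow)
    finally show "x \<otimes>\<^bsub>G\<^esub> y \<in> torsion_elements G"
      unfolding torsion_elements_def using x y by (auto intro!: exI[of _ "m * n"])
  qed
qed

text \<open>All that the counting argument needs of the rank: the quotient map by torsion followed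
  by the isomorphism is additive and reaches the \<open>r\<close> basis vectors.\<close>

lemma has_rank_hom:
  assumes "has_rank G r"
  obtains \<phi> where "\<And>x y. x \<in> carrier G \<Longrightarrow> y \<in> carrier G \<Longrightarrow> \<phi> (x \<otimes>\<^bsub>G\<^esub> y) = \<phi> x + \<phi> y"
    and "\<And>j. j < r \<Longrightarrow> \<exists>x\<in>carrier G. \<phi> x = frag_of j"
proof -
  define T where "T = torsion_elements G"
  interpret comm_group G using assms by (simp add: has_rank_def)
  have "T \<lhd> G" unfolding T_def
    by (intro subgroup_imp_normal torsion_subgroup) (rule comm_group_axioms)
  then interpret normal T G .
  obtain h where h: "h \<in> iso (G Mod T) (free_Abelian_group {..<r})"
    using assms by (auto simp: has_rank_def is_iso_def T_def)
  have car: "carrier (G Mod T) = (\<lambda>x. T #>\<^bsub>G\<^esub> x) ` carrier G"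
    by (auto simp: FactGroup_def RCOSETS_def)
  show ?thesis
  proof (rule that[of "\<lambda>x. h (T #>\<^bsub>G\<^esub> x)"])
    fix x y assume xy: "x \<in> carrier G" "y \<in> carrier G"
    then have "h ((T #>\<^bsub>G\<^esub> x) \<otimes>\<^bsub>G Mod T\<^esub> (T #>\<^bsub>G\<^esub> y)) = h (T #>\<^bsub>G\<^esub> x) + h (T #>\<^bsub>G\<^esub> y)"
      using h hom_mult[of h "G Mod T" "free_Abelian_group {..<r}"] by (simp add: iso_def car)
    then show "h (T #>\<^bsub>G\<^esub> (x \<otimes>\<^bsub>G\<^esub> y)) = h (T #>\<^bsub>G\<^esub> x) + h (T #>\<^bsub>G\<^esub> y)"
      using xy by (simp add: FactGroup_def rcos_sum)
  next
    fix j assume "j < r"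
    then have "frag_of j \<in> h ` carrier (G Mod T)"
      using h by (auto simp: iso_def bij_betw_def)
    then show "\<exists>x\<in>carrier G. h (T #>\<^bsub>G\<^esub> x) = frag_of j"
      by (auto simp: car)
  qed
qed

text \<open>Boxes of side \<open>N\<close> in \<open>\<int>\<^sup>r\<close> give \<open>(N + 1)\<^sup>r\<close> distinct elements of \<open>U\<close>, while their images
  under \<open>L\<close> meet only \<open>O(N\<^sup>r\<^sup>-\<^sup>1)\<close> unit cubes; so some cube contains arbitrarily many of them.\<close>

lemma free_quotient_pigeonhole:
  fixes U :: "'k::field set" and \<phi> :: "'k \<Rightarrow> nat \<Rightarrow>\<^sub>0 int" and L :: "'i \<Rightarrow> 'k \<Rightarrow> real"
  assumes one: "1 \<in> U" and zero: "0 \<notin> U"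
    and mult: "\<And>u v. u \<in> U \<Longrightarrow> v \<in> U \<Longrightarrow> u * v \<in> U"
    and divide: "\<And>u v. u \<in> U \<Longrightarrow> v \<in> U \<Longrightarrow> u / v \<in> U"
    and \<phi>_mult: "\<And>u v. u \<in> U \<Longrightarrow> v \<in> U \<Longrightarrow> \<phi> (u * v) = \<phi> u + \<phi> v"
    and \<phi>_surj: "\<And>j. j < r \<Longrightarrow> \<exists>u\<in>U. \<phi> u = frag_of j"
    and L_mult: "\<And>i u v. i \<in> I \<Longrightarrow> u \<in> U \<Longrightarrow> v \<in> U \<Longrightarrow> L i (u * v) = L i u + L i v"
    and I: "finite I" "card I < r"
  shows "infinite {u \<in> U. \<forall>i\<in>I. \<bar>L i u\<bar> \<le> 1}"
proof
  define V where "V = {u \<in> U. \<forall>i\<in>I. \<bar>L i u\<bar> \<le> 1}"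
  assume "finite {u \<in> U. \<forall>i\<in>I. \<bar>L i u\<bar> \<le> 1}"
  then have V: "finite V" by (simp add: V_def)
  obtain e where e: "\<And>j. j < r \<Longrightarrow> e j \<in> U" "\<And>j. j < r \<Longrightarrow> \<phi> (e j) = frag_of j"
    using \<phi>_surj by metis
  have \<phi>_one: "\<phi> 1 = 0" using \<phi>_mult[OF one one] by simp
  have L_one: "L i 1 = 0" if "i \<in> I" for i using L_mult[OF that one one] by simp
  have pow: "u ^ n \<in> U \<and> Poly_Mapping.lookup (\<phi> (u ^ n)) j = int n * Poly_Mapping.lookup (\<phi> u) j
      \<and> (\<forall>i\<in>I. L i (u ^ n) = real n * L i u)" if "u \<in> U" for u n j
    by (induction n) (auto simp: that one mult \<phi>_one L_one \<phi>_mult L_mult lookup_add algebra_simps)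
  define w where "w J a = (\<Prod>j\<in>J. e j ^ a j)" for J and a :: "nat \<Rightarrow> nat"
  \<comment> \<open>The coordinates of \<open>\<phi>\<close> recover the exponents, so different
    exponent vectors give different elements, while each \<open>L i\<close> is linear in the
    exponents.\<close>
  have w_aux: "w J a \<in> U \<and> (\<forall>k. Poly_Mapping.lookup (\<phi> (w J a)) k = (if k \<in> J then int (a k) else 0))
      \<and> (\<forall>i\<in>I. L i (w J a) = (\<Sum>j\<in>J. real (a j) * L i (e j)))"
    if "finite J" "J \<subseteq> {..<r}" for J a
    using that
  proof (induction J rule: finite_induct)
    case empty
    show ?case by (simp add: w_def one \<phi>_one L_one)
  next
    case (insert x J)
    then have x: "x < r" by simp
    have IH: "w J a \<in> U" "\<And>k. Poly_Mapping.lookup (\<phi> (w J a)) k = (if k \<in> J then int (a k) else 0)"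
      "\<And>i. i \<in> I \<Longrightarrow> L i (w J a) = (\<Sum>j\<in>J. real (a j) * L i (e j))"
      using insert by auto
    have eq: "w (insert x J) a = e x ^ a x * w J a" using insert.hyps by (simp add: w_def)
    note p = pow[OF e(1)[OF x], of "a x"]
    show ?case
      unfolding eq using p IH insert.hyps
      by (auto simp: mult \<phi>_mult L_mult lookup_add e(2)[OF x] lookup_frag_of when_def)
  qed
  define W where "W = w {..<r}"
  have W: "W a \<in> U" "\<And>k. k < r \<Longrightarrow> Poly_Mapping.lookup (\<phi> (W a)) k = int (a k)"
    "\<And>i. i \<in> I \<Longrightarrow> L i (W a) = (\<Sum>j<r. real (a j) * L i (e j))" for a
    using w_aux[of "{..<r}" a] by (auto simp: W_def)
  \<comment> \<open>\<open>D\<close> bounds the growth of every \<open>L i\<close> per unit of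
    exponent, so exponents up to \<open>N\<close> give values between \<open>- D * N\<close> and
    \<open>D * N\<close>.\<close>
  define D where "D = nat \<lceil>\<Sum>i\<in>I. \<Sum>j<r. \<bar>L i (e j)\<bar>\<rceil>"
  have D: "(\<Sum>j<r. \<bar>L i (e j)\<bar>) \<le> D" if "i \<in> I" for i
  proof -
    have "(\<Sum>j<r. \<bar>L i (e j)\<bar>) \<le> (\<Sum>i\<in>I. \<Sum>j<r. \<bar>L i (e j)\<bar>)"
      using that I by (intro member_le_sum) (auto intro: sum_nonneg)
    then show ?thesis unfolding D_def by linarith
  qed
  \<comment> \<open>Chosen so that the final count compares \<open>N\<close> with
    \<open>N + 1\<close>: there are at most \<open>card V\<close> elements in a cell, and each
    coordinate costs a factor \<open>2 * D + 1\<close>.\<close>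
  define N where "N = card V * (2 * D + 1) ^ card I"
  define A where "A = ({..<r} \<rightarrow>\<^sub>E {..N})"
  define C where "C = (I \<rightarrow>\<^sub>E {- int (D * N)..int (D * N)})"
  define cell where "cell a = (\<lambda>i\<in>I. \<lfloor>L i (W a)\<rfloor>)" for a
  have W_inj: "inj_on W A"
  proof (rule inj_onI)
    fix a b assume ab: "a \<in> A" "b \<in> A" "W a = W b"
    then have "a k = b k" if "k < r" for k using W(2)[OF that, of a] W(2)[OF that, of b] by simp
    then show "a = b" using ab(1,2) unfolding A_def by (intro PiE_ext) auto
  qed
  have cell: "cell a \<in> C" if a: "a \<in> A" for a
  proof -
    have "\<bar>L i (W a)\<bar> \<le> real (D * N)" if i: "i \<in> I" for i
    proof -
      have "\<bar>real (a j) * L i (e j)\<bar> \<le> real N * \<bar>L i (e j)\<bar>" if "j < r" for j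
      proof -
        have "a j \<le> N" using PiE_mem[OF a[unfolded A_def], of j] that by simp
        then show ?thesis unfolding abs_mult by (intro mult_right_mono) auto
      qed
      then have "\<bar>L i (W a)\<bar> \<le> (\<Sum>j<r. real N * \<bar>L i (e j)\<bar>)"
        unfolding W(3)[OF i] by (intro order_trans[OF sum_abs] sum_mono) simp
      also have "\<dots> \<le> real N * real D"
        unfolding sum_distrib_left[symmetric] using D[OF i] by (intro mult_left_mono) auto
      finally show ?thesis by (simp add: mult.commute)
    qed
    moreover have "\<lfloor>x\<rfloor> \<in> {- int M..int M}" if "\<bar>x\<bar> \<le> real M" for x :: real and M
      using that by (auto simp: abs_le_iff le_floor_iff floor_le_iff)
    ultimately have "\<lfloor>L i (W a)\<rfloor> \<in> {- int (D * N)..int (D * N)}" if "i \<in> I" for i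
      using that by blast
    then show ?thesis by (auto simp: C_def cell_def)
  qed
  \<comment> \<open>Division by a fixed element of the cell is injective, and equal floors mean that
    logarithms differ by less than 1, so the quotients lie in \<open>V\<close>.\<close>
  have fibre: "card {a \<in> A. cell a = c} \<le> card V" for c
  proof (cases "{a \<in> A. cell a = c} = {}")
    case False
    then obtain b where b: "b \<in> A" "cell b = c" by blast
    show ?thesis
    proof (rule card_inj_on_le[where f = "\<lambda>a. W a / W b"])
      have "W b \<noteq> 0" using W(1)[of b] zero by auto
      then show "inj_on (\<lambda>a. W a / W b) {a \<in> A. cell a = c}"
        using W_inj by (auto simp: inj_on_def)
      show "(\<lambda>a. W a / W b) ` {a \<in> A. cell a = c} \<subseteq> V"
      proof safe
        fix a assume a: "a \<in> A" "c = cell a"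
        have "\<bar>L i (W a / W b)\<bar> \<le> 1" if i: "i \<in> I" for i
        proof -
          have "L i (W a) = L i (W a / W b) + L i (W b)"
            using L_mult[OF i divide[OF W(1) W(1)] W(1), of a b b] \<open>W b \<noteq> 0\<close> by simp
          moreover have "\<lfloor>L i (W a)\<rfloor> = \<lfloor>L i (W b)\<rfloor>"
            using a(2) b(2) i by (metis cell_def restrict_apply')
          ultimately show ?thesis by linarith
        qed
        then show "W a / W b \<in> V" using W(1) divide by (auto simp: V_def)
      qed
    qed (rule V)
  next
    case True
    then show ?thesis by (simp only: card.empty)
  qed
  have "finite C" unfolding C_def using I by (intro finite_PiE) auto
  have "card A \<le> card (\<Union>c\<in>C. {a \<in> A. cell a = c})"
    using cell \<open>finite C\<close> by (intro card_mono) (auto simp: A_def intro!: finite_PiE)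
  also have "\<dots> \<le> (\<Sum>c\<in>C. card {a \<in> A. cell a = c})"
    using \<open>finite C\<close> by (rule card_UN_le)
  also have "\<dots> \<le> card C * card V"
    using sum_bounded_above[of C "\<lambda>c. card {a \<in> A. cell a = c}" "card V"] fibre by simp
  also have "card C = (2 * D * N + 1) ^ card I"
    unfolding C_def using I by (simp add: card_PiE nat_add_distrib nat_mult_distrib mult.assoc flip: of_nat_mult)
  also have "card A = (N + 1) ^ r" by (simp add: A_def card_PiE)
  finally have "(N + 1) ^ r \<le> (2 * D * N + 1) ^ card I * card V" .
  \<comment> \<open>A generous bound that turns the number of cells into a constant times a power of
    \<open>N + 1\<close>.\<close>
  also have "\<dots> \<le> ((2 * D + 1) * (N + 1)) ^ card I * card V"
    by (intro mult_right_mono power_mono) (auto simp: algebra_simps)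
  also have "\<dots> = card V * (2 * D + 1) ^ card I * (N + 1) ^ card I"
    by (simp only: power_mult_distrib mult_ac)
  also have "\<dots> = N * (N + 1) ^ card I" by (simp only: N_def)
  also have "\<dots> < (N + 1) ^ Suc (card I)" by simp
  also have "\<dots> \<le> (N + 1) ^ r" using I by (intro power_increasing) auto
  finally show False by simp
qed

section \<open>Units of the number field and the contradiction\<close>

lemma unit_group_carrier:
  assumes "u \<in> carrier (unit_group :: 'k::field_char_0 monoid)"
  obtains v where "algebraic_int u" "algebraic_int v" "u * v = 1"
  using assms by (auto simp: unit_group_def units_of_def Units_def ring_of_integers_def)

theorem proposition2:
  fixes s t :: nat
    and \<sigma> :: "nat \<Rightarrow> 'k::field_char_0 \<Rightarrow> complex"
  assumes "number_field TYPE('k)"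
    and signature: "has_signature TYPE('k) s t"
    and embeddings: "bij_betw \<sigma> {1..s + 2 * t} {f. complex_embedding f}"
    and real: "bij_betw \<sigma> {1..s} real_embeddings"
    and conjugate: "\<And>k x. k \<in> {1..t} \<Longrightarrow> cnj (\<sigma> (s + k) x) = \<sigma> (s + t + k) x"
    and "s \<ge> 1" and "t \<ge> 2" and "s \<ge> 2 * t"
  shows "\<not> (\<exists>U. subgroup U (unit_group :: 'k monoid) \<and>
              has_rank ((unit_group :: 'k monoid)\<lparr>carrier := U\<rparr>) s \<and>
              (\<forall>u\<in>U. \<forall>j\<in>{1..t}. \<forall>k\<in>{1..t}.
                 \<sigma> (s + j) u * \<sigma> (s + t + j) u = \<sigma> (s + k) u * \<sigma> (s + t + k) u))"
proof
  assume "\<exists>U. subgroup U (unit_group :: 'k monoid) \<and>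
              has_rank ((unit_group :: 'k monoid)\<lparr>carrier := U\<rparr>) s \<and>
              (\<forall>u\<in>U. \<forall>j\<in>{1..t}. \<forall>k\<in>{1..t}.
                 \<sigma> (s + j) u * \<sigma> (s + t + j) u = \<sigma> (s + k) u * \<sigma> (s + t + k) u)"
  then obtain U where sub: "subgroup U (unit_group :: 'k monoid)"
    and rank: "has_rank ((unit_group :: 'k monoid)\<lparr>carrier := U\<rparr>) s"
    and rel: "\<And>u j k. u \<in> U \<Longrightarrow> j \<in> {1..t} \<Longrightarrow> k \<in> {1..t} \<Longrightarrow>
      \<sigma> (s + j) u * \<sigma> (s + t + j) u = \<sigma> (s + k) u * \<sigma> (s + t + k) u"
    by blast
  note K = \<open>number_field TYPE('k)\<close>
  have fin: "finite {f :: 'k \<Rightarrow> complex. complex_embedding f}"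
    using bij_betw_finite[OF embeddings] by simp
  have emb: "complex_embedding (\<sigma> i)" if "i \<in> {1..s + 2 * t}" for i
    using embeddings that by (auto simp: bij_betw_def)
  define G where "G = (unit_group :: 'k monoid)\<lparr>carrier := U\<rparr>"
  have G: "carrier G = U" "\<one>\<^bsub>G\<^esub> = 1" "\<And>x y. x \<otimes>\<^bsub>G\<^esub> y = x * y"
    by (simp_all add: G_def unit_group_def units_of_def ring_of_integers_def)
  interpret G: comm_group G using rank by (simp add: has_rank_def G_def)
  have unit: "\<exists>v. algebraic_int u \<and> algebraic_int v \<and> u * v = 1" if "u \<in> U" for u
    using subgroup.subset[OF sub] that unit_group_carrier by (metis subsetD)
  then have nonzero: "u \<noteq> 0" if "u \<in> U" for u using that by force
  have U_one: "1 \<in> U" using G.one_closed by (simp add: G)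
  have U_mult: "u * v \<in> U" if "u \<in> U" "v \<in> U" for u v
    using G.m_closed that by (simp add: G)
  have U_divide: "u / v \<in> U" if "u \<in> U" "v \<in> U" for u v
  proof -
    obtain y where "y \<in> U" "y * v = 1" using G.l_inv_ex \<open>v \<in> U\<close> by (auto simp: G)
    then have "y = inverse v" by (metis inverse_unique mult.commute)
    then show ?thesis using U_mult[OF \<open>u \<in> U\<close> \<open>y \<in> U\<close>] by (simp add: divide_inverse)
  qed
  define L where "L i u = ln (norm (\<sigma> i u))" for i u
  have \<sigma>_pos: "norm (\<sigma> i u) > 0" if "u \<in> U" "i \<in> {1..s + 2 * t}" for i u
    using that nonzero emb by (simp add: embedding_eq_0_iff)
  have L_mult: "L i (u * v) = L i u + L i v" if "u \<in> U" "v \<in> U" "i \<in> {1..s + 2 * t}" for i u v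
    using \<sigma>_pos[OF that(1,3)] \<sigma>_pos[OF that(2,3)] emb[OF that(3)]
    by (simp add: L_def embedding_mult norm_mult ln_mult)
  have L_complex: "L i u = L (s + 1) u" if u: "u \<in> U" and i: "i \<in> {s + 1..s + 2 * t}" for i u
  proof -
    have conj_norm: "norm (\<sigma> (s + t + j) u) = norm (\<sigma> (s + j) u)" if "j \<in> {1..t}" for j
      using conjugate[OF that] by (metis complex_mod_cnj)
    have "norm (\<sigma> (s + j) u) = norm (\<sigma> (s + 1) u)" if j: "j \<in> {1..t}" for j
    proof -
      have "1 \<in> {1..t}" using \<open>t \<ge> 2\<close> by simp
      \<comment> \<open>Both sides are products of a number and its complex conjugate, so the
        relation equates squares of norms.\<close>
      have "norm (\<sigma> (s + j) u * \<sigma> (s + t + j) u) = norm (\<sigma> (s + 1) u * \<sigma> (s + t + 1) u)"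
        using rel[OF u j \<open>1 \<in> {1..t}\<close>] by simp
      then have "norm (\<sigma> (s + j) u) ^ 2 = norm (\<sigma> (s + 1) u) ^ 2"
        unfolding norm_mult conj_norm[OF j] conj_norm[OF \<open>1 \<in> {1..t}\<close>] by (simp add: power2_eq_square)
      then show ?thesis by simp
    qed
    moreover have "(\<exists>j\<in>{1..t}. i = s + j) \<or> (\<exists>j\<in>{1..t}. i = s + t + j)"
    proof (cases "i \<le> s + t")
      case True
      then show ?thesis using i by (intro disjI1 bexI[of _ "i - s"]) auto
    next
      case False
      then show ?thesis using i by (intro disjI2 bexI[of _ "i - s - t"]) auto
    qed
    ultimately have "norm (\<sigma> i u) = norm (\<sigma> (s + 1) u)" using conj_norm by metis
    then show ?thesis by (simp add: L_def)
  qed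
  have L_sum: "(\<Sum>i=1..s. L i u) + 2 * real t * L (s + 1) u = 0" if u: "u \<in> U" for u
  proof -
    obtain v where "algebraic_int u" "algebraic_int v" "u * v = 1" using unit[OF u] by blast
    \<comment> \<open>The product formula for units; its logarithm, split after index
      \<open>s\<close>, is the claim.\<close>
    then have "(\<Prod>g | complex_embedding g. norm (g u)) = 1" by (rule unit_prod_conjugates[OF K fin])
    then have "(\<Prod>i=1..s + 2 * t. norm (\<sigma> i u)) = 1"
      unfolding prod.reindex_bij_betw[OF embeddings, of "\<lambda>g. norm (g u)"] .
    moreover have "ln (\<Prod>i=1..s + 2 * t. norm (\<sigma> i u)) = (\<Sum>i=1..s + 2 * t. L i u)"
      unfolding L_def
    proof (rule ln_prod)
      show "norm (\<sigma> i u) \<noteq> 0" if "i \<in> {1..s + 2 * t}" for i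
        using \<sigma>_pos[OF u that] by simp
    qed simp
    ultimately have "(\<Sum>i=1..s + 2 * t. L i u) = 0" by simp
    moreover have "(\<Sum>i=1..s + 2 * t. L i u) = (\<Sum>i=1..s. L i u) + (\<Sum>i=s + 1..s + 2 * t. L i u)"
      using \<open>s \<ge> 1\<close> by (intro sum.ub_add_nat) simp
    moreover have "(\<Sum>i=s + 1..s + 2 * t. L i u) = (\<Sum>i=s + 1..s + 2 * t. L (s + 1) u)"
      using L_complex[OF u] by (rule sum.cong[OF refl])
    moreover have "(\<Sum>i=s + 1..s + 2 * t. L (s + 1) u) = 2 * real t * L (s + 1) u" by simp
    ultimately show ?thesis by (simp only:)
  qed
  have one_mem: "1 \<in> {1..s + 2 * t}" and s1_mem: "s + 1 \<in> {1..s + 2 * t}"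
    using \<open>s \<ge> 1\<close> \<open>t \<ge> 2\<close> by auto
  obtain \<tau> where \<tau>: "\<And>z. z \<in> range (\<sigma> (s + 1)) \<Longrightarrow> \<tau> z = \<sigma> 1 (inv_into UNIV (\<sigma> (s + 1)) z)"
    and \<tau>_emb: "\<And>g :: 'k \<Rightarrow> complex. complex_embedding g \<Longrightarrow> complex_embedding (\<tau> \<circ> g)"
    and \<tau>_inj: "inj_on (\<lambda>g :: 'k \<Rightarrow> complex. \<tau> \<circ> g) {g. complex_embedding g}"
    and \<tau>_mult: "\<And>(g :: 'k \<Rightarrow> complex) (h :: 'k \<Rightarrow> complex) x y.
      complex_embedding g \<Longrightarrow> complex_embedding h \<Longrightarrow> \<tau> (g x * h y) = \<tau> (g x) * \<tau> (h y)"
    by (rule extend_to_conjugates[OF K fin partial_hom_embeddings[OF emb[OF s1_mem] emb[OF one_mem]]]) (rule that)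
  have \<tau>_s1: "\<tau> \<circ> \<sigma> (s + 1) = \<sigma> 1"
  proof
    fix x
    have "\<tau> (\<sigma> (s + 1) x) = \<sigma> 1 (inv_into UNIV (\<sigma> (s + 1)) (\<sigma> (s + 1) x))"
      by (rule \<tau>) (rule rangeI)
    then show "(\<tau> \<circ> \<sigma> (s + 1)) x = \<sigma> 1 x"
      by (simp only: comp_apply inv_f_f[OF embedding_inj[OF emb[OF s1_mem]]])
  qed
  \<comment> \<open>Composition with \<open>\<tau>\<close> is injective and
    \<open>\<sigma> (s + 1)\<close> already goes to \<open>\<sigma> 1\<close>, so no other embedding
    does.\<close>
  have \<tau>_other: "\<exists>j\<in>{2..s + 2 * t}. \<tau> \<circ> \<sigma> i = \<sigma> j" if i: "i \<in> {1..s + 2 * t}" "i \<noteq> s + 1" for i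
  proof -
    have "\<tau> \<circ> \<sigma> i \<in> \<sigma> ` {1..s + 2 * t}"
      using \<tau>_emb[OF emb[OF i(1)]] embeddings by (simp add: bij_betw_def)
    then obtain j where j: "j \<in> {1..s + 2 * t}" "\<tau> \<circ> \<sigma> i = \<sigma> j" by blast
    have "j \<noteq> 1"
    proof
      assume "j = 1"
      then have "\<tau> \<circ> \<sigma> i = \<tau> \<circ> \<sigma> (s + 1)" using j(2) \<tau>_s1 by simp
      then have "\<sigma> i = \<sigma> (s + 1)"
        by (rule inj_onD[OF \<tau>_inj]) (simp_all only: mem_Collect_eq emb[OF i(1)] emb[OF s1_mem])
      then show False
        using inj_onD[OF bij_betw_imp_inj_on[OF embeddings] _ i(1) s1_mem] i(2) by blast
    qed
    with j(1) have "j \<in> {2..s + 2 * t}" by auto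
    with j(2) show ?thesis by blast
  qed
  \<comment> \<open>Here \<open>t \<ge> 2\<close> ensures that the other three indices in the
    relation are in range and differ from \<open>s + 1\<close>.\<close>
  obtain a where a: "a \<in> {2..s + 2 * t}" "\<tau> \<circ> \<sigma> (s + t + 1) = \<sigma> a"
    using \<tau>_other[of "s + t + 1"] \<open>t \<ge> 2\<close> by auto
  obtain b where b: "b \<in> {2..s + 2 * t}" "\<tau> \<circ> \<sigma> (s + 2) = \<sigma> b"
    using \<tau>_other[of "s + 2"] \<open>t \<ge> 2\<close> by auto
  obtain c where c: "c \<in> {2..s + 2 * t}" "\<tau> \<circ> \<sigma> (s + t + 2) = \<sigma> c"
    using \<tau>_other[of "s + t + 2"] \<open>t \<ge> 2\<close> by auto
  \<comment> \<open>The transported relation in logarithmic form. Which of \<open>a\<close>,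
    \<open>b\<close>, \<open>c\<close> are real indices is unknown, so \<open>log_bound\<close>
    allows for either kind.\<close>
  have L_rel: "L 1 u + L a u = L b u + L c u" if u: "u \<in> U" for u
  proof -
    have "\<sigma> (s + 1) u * \<sigma> (s + t + 1) u = \<sigma> (s + 2) u * \<sigma> (s + t + 2) u"
      using rel[OF u, of 1 2] \<open>t \<ge> 2\<close> by simp
    then have "\<tau> (\<sigma> (s + 1) u) * \<tau> (\<sigma> (s + t + 1) u) = \<tau> (\<sigma> (s + 2) u) * \<tau> (\<sigma> (s + t + 2) u)"
      using \<tau>_mult[of "\<sigma> (s + 1)" "\<sigma> (s + t + 1)" u u] \<tau>_mult[of "\<sigma> (s + 2)" "\<sigma> (s + t + 2)" u u]
        emb[of "s + 1"] emb[of "s + t + 1"] emb[of "s + 2"] emb[of "s + t + 2"] \<open>t \<ge> 2\<close>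
      by simp
    then have "\<sigma> 1 u * \<sigma> a u = \<sigma> b u * \<sigma> c u"
      using fun_cong[OF \<tau>_s1, of u] fun_cong[OF a(2), of u] fun_cong[OF b(2), of u]
        fun_cong[OF c(2), of u] by simp
    then have "ln (norm (\<sigma> 1 u) * norm (\<sigma> a u)) = ln (norm (\<sigma> b u) * norm (\<sigma> c u))"
      by (simp flip: norm_mult)
    then show ?thesis
      using \<sigma>_pos[OF u, of 1] \<sigma>_pos[OF u, of a] \<sigma>_pos[OF u, of b] \<sigma>_pos[OF u, of c] a(1) b(1) c(1) one_mem
      by (simp add: L_def ln_mult)
  qed
  \<comment> \<open>Bounds on all real logarithms but the first bound every conjugate, so only
    finitely many elements of \<open>U\<close> qualify.\<close>
  have "{u \<in> U. \<forall>i\<in>{2..s}. \<bar>L i u\<bar> \<le> 1}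
      \<subseteq> {u. algebraic_int u \<and> (\<forall>g. complex_embedding g \<longrightarrow> norm (g u) \<le> exp (3 * real s + 6))}"
  proof safe
    fix u assume u: "u \<in> U" "\<forall>i\<in>{2..s}. \<bar>L i u\<bar> \<le> 1"
    then show "algebraic_int u" using unit by blast
    fix g :: "'k \<Rightarrow> complex" assume "complex_embedding g"
    then have "g \<in> \<sigma> ` {1..s + 2 * t}" using embeddings by (simp add: bij_betw_def)
    then obtain h where h: "h \<in> {1..s + 2 * t}" "g = \<sigma> h" by blast
    have "\<bar>L h u\<bar> \<le> 3 * real s + 6"
    proof (rule log_bound[OF \<open>s \<ge> 1\<close> \<open>t \<ge> 2\<close> L_sum[OF u(1)] _ a(1) b(1) c(1) L_rel[OF u(1)] _ h(1)])
      show "L i u = L (s + 1) u" if "i \<in> {s + 1..s + 2 * t}" for i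
        using L_complex[OF u(1) that] .
      show "\<bar>L i u\<bar> \<le> 1" if "i \<in> {2..s}" for i
        using u(2) that by blast
    qed
    then have "ln (norm (g u)) \<le> 3 * real s + 6" by (simp add: L_def h(2))
    then show "norm (g u) \<le> exp (3 * real s + 6)"
      using \<sigma>_pos[OF u(1) h(1)] h(2) by (metis exp_le_cancel_iff exp_ln)
  qed
  then have "finite {u \<in> U. \<forall>i\<in>{2..s}. \<bar>L i u\<bar> \<le> 1}"
    by (rule finite_subset) (intro finite_bounded_conjugates[OF K fin emb[OF one_mem]] exp_ge_zero)
  moreover obtain \<phi> :: "'k \<Rightarrow> nat \<Rightarrow>\<^sub>0 int"
    where \<phi>: "\<And>x y. x \<in> U \<Longrightarrow> y \<in> U \<Longrightarrow> \<phi> (x * y) = \<phi> x + \<phi> y"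
      "\<And>j. j < s \<Longrightarrow> \<exists>x\<in>U. \<phi> x = frag_of j"
    using has_rank_hom[OF rank] unfolding G_def[symmetric] G by metis
  have "infinite {u \<in> U. \<forall>i\<in>{2..s}. \<bar>L i u\<bar> \<le> 1}"
  \<comment> \<open>The index set \<open>{2..s}\<close> has \<open>s - 1\<close> elements, one fewer
    than the rank, so the pigeonhole argument makes the set just shown finite infinite.\<close>
  proof (rule free_quotient_pigeonhole[where \<phi> = \<phi> and r = s])
    show "L i (u * v) = L i u + L i v" if "i \<in> {2..s}" "u \<in> U" "v \<in> U" for i u v
      using that L_mult by simp
  qed (use U_one U_mult U_divide nonzero[of 0] \<phi> \<open>s \<ge> 1\<close> in auto)
  ultimately show False by blast
qed

end
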